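(* Assume the setting and notation in the context. Suppose the scores $\{T_i\}$ and residuals $\{R_i\}$ ($i\in\mathcal C\cup\mathcal U$) are continuous random variables, and the ranking threshold is $\hat\kappa=\kappa(T_i:i\in\mathcal C\cup\mathcal U)$ for a deterministic measurable $\kappa:\mathbb R^{n+m}\to\{1,\dots,m\}$ (calibration-assisted selection). For $j\in\mathcal U$, $k\in\mathcal C$ and reals $t,s$, let $\hat\kappa^{j\leftarrow t}$ be the value of $\kappa$ after replacing $T_j$ by $t$, and $\hat\kappa^{(j,k)\leftarrow(t,s)}$ the value after simultaneously replacing $T_j$ by $t$ and $T_k$ by $s$. Let $\hat{\mathcal S}_u=\{j\in\mathcal U:T_j\le T_{(\hat\kappa)}\}$ and $\hat{\mathcal S}_c^+=\{i\in\mathcal C:T_i\le T_{(\hat\kappa+1)}\}$. Assume: (A) there exist deterministic $t_u,t_c\in\mathbb R$, integers $I_u,I_c\ge0$ and $\gamma\in(0,1)$ such that almost surely: $\hat\kappa^{j\leftarrow t_u}=\hat\kappa$ for all $j\in\hat{\mathcal S}_u$; $\hat\kappa\le\hat\kappa^{j\leftarrow t_u}\le\hat\kappa+I_u$ for all $j\in\mathcal U\setminus\hat{\mathcal S}_u$; $\hat\kappa^{j\leftarrow t_u}\le\hat\kappa^{(j,k)\leftarrow(t_u,t_c)}\le\hat\kappa^{j\leftarrow t_u}+I_c$ for all $j\in\mathcal U,k\in\mathcal C$; and $\lceil\gamma m\rceil\le\hat\kappa\le m-1$; (B) letting $F_R,F_T$ be the CDFs of $R_i$ and $T_i$ and $F_{(R,T)}$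 the joint CDF of $(F_R(R_i),F_T(T_i))$, there is $\rho\in(0,1)$ with $\partial F_{(R,T)}(r,t)/\partial r\ge\rho t$ for all $t\in[\gamma/2,1]$ and $r\in(0,1)$. If $n\gamma\ge256\log n$ and $m\gamma\ge32\log m$, then the intervals $\mathrm{PI}_j=[\hat\mu(X_j)\pm Q_\alpha(\{R_i\}_{i\in\hat{\mathcal S}_c^+})]$, $j\in\hat{\mathcal S}_u$, satisfy $$\mathrm{FCR}-\alpha=O\Big\{\frac{1}{\rho\gamma^3}\Big(\frac{I_c\log m}{m}+\frac{\log n}{n}\Big)+\frac{I_u\log m}{m\gamma}\Big\},$$ i.e. $|\mathrm{FCR}-\alpha|$ is bounded by an absolute constant times the quantity in braces.
   Context: Setting: $\hat\mu:\mathbb R^d\to\mathbb R$ and $g:\mathbb R^d\to\mathbb R$ are fixed deterministic measurable functions. Calibration indices $\mathcal C$, $|\mathcal C|=n$; test indices $\mathcal U$ (disjoint), $|\mathcal U|=m$. The pairs $(X_i,Y_i)\in\mathbb R^d\times\mathbb R$, $i\in\mathcal C\cup\mathcal U$, are i.i.d. Scores $T_i=g(X_i)$, residuals $R_i=|Y_i-\hat\mu(X_i)|$, $\alpha\in(0,1)$. $T_{(r)}$ denotes the $r$-th smallest value of the test scores $\{T_i\}_{i\in\mathcal U}$. For a finite index set $S$, $Q_\alpha(\{R_i\}_{i\in S})$ is the $\lceil(1-\alpha)(|S|+1)\rceil$-th smallest value of $\{R_i\}_{i\in S}$, equal to $+\infty$ if that index exceeds $|S|$. $\mathrm{FCR}=\mathbb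 E\Big[\frac{|\{j\in\hat{\mathcal S}_u: Y_j\notin\mathrm{PI}_j\}|}{\max\{|\hat{\mathcal S}_u|,1\}}\Big]$.
   Formalization: The formal statement assumes n ≥ 2: for n = 1 the term log n / n vanishes and the bound fails (constant κ, I_u = I_c = 0, α < 1/2 gives an infinite quantile and FCR = 0, while the bound is 0). *)

theory Defs
  imports "HOL-Probability.Probability"
begin

text \<open>A data point is a pair (feature vector, label). Feature vectors in R^d are
  represented as elements of the product space PiM {..<d} (\<lambda>_. borel).
  A full sample is a map omega from indices (naturals) to data points.\<close>

type_synonym point = "(nat \<Rightarrow> real) \<times> real"
type_synonym sample = "nat \<Rightarrow> point"

definition feature_space :: "nat \<Rightarrow> (nat \<Rightarrow> real) measure" where
  "feature_space d = (\<Pi>\<^sub>M i\<in>{..<d}. (borel :: real measure))"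

definition point_space :: "nat \<Rightarrow> point measure" where
  "point_space d = feature_space d \<Otimes>\<^sub>M (borel :: real measure)"

definition score :: "((nat \<Rightarrow> real) \<Rightarrow> real) \<Rightarrow> sample \<Rightarrow> nat \<Rightarrow> real" where
  "score g \<omega> i = g (fst (\<omega> i))"

definition resid :: "((nat \<Rightarrow> real) \<Rightarrow> real) \<Rightarrow> sample \<Rightarrow> nat \<Rightarrow> real" where
  "resid mu \<omega> i = \<bar>snd (\<omega> i) - mu (fst (\<omega> i))\<bar>"

definition kth_smallest :: "nat set \<Rightarrow> (nat \<Rightarrow> real) \<Rightarrow> nat \<Rightarrow> real" where
  "kth_smallest A f r = sort (map f (sorted_list_of_set A)) ! (r - 1)"

definition conf_quantile :: "real \<Rightarrow> nat set \<Rightarrow> (nat \<Rightarrow> real) \<Rightarrow> ereal" where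
  "conf_quantile \<alpha> S f =
     (let k = nat \<lceil>(1 - \<alpha>) * (real (card S) + 1)\<rceil>
      in if k > card S then \<infinity> else ereal (kth_smallest S f k))"

definition score_vec :: "((nat \<Rightarrow> real) \<Rightarrow> real) \<Rightarrow> nat set \<Rightarrow> sample \<Rightarrow> (nat \<Rightarrow> real)" where
  "score_vec g I \<omega> = restrict (score g \<omega>) I"

definition khat :: "((nat \<Rightarrow> real) \<Rightarrow> nat) \<Rightarrow> ((nat \<Rightarrow> real) \<Rightarrow> real) \<Rightarrow> nat set \<Rightarrow> nat set \<Rightarrow> sample \<Rightarrow> nat" where
  "khat \<kappa> g C U \<omega> = \<kappa> (score_vec g (C \<union> U) \<omega>)"

definition khat_rep1 :: "((nat \<Rightarrow> real) \<Rightarrow> nat) \<Rightarrow> ((nat \<Rightarrow> real) \<Rightarrow> real) \<Rightarrow> nat set \<Rightarrow> nat set \<Rightarrow> sample \<Rightarrow> nat \<Rightarrow> real \<Rightarrow> nat" where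
  "khat_rep1 \<kappa> g C U \<omega> j t = \<kappa> ((score_vec g (C \<union> U) \<omega>)(j := t))"

definition khat_rep2 :: "((nat \<Rightarrow> real) \<Rightarrow> nat) \<Rightarrow> ((nat \<Rightarrow> real) \<Rightarrow> real) \<Rightarrow> nat set \<Rightarrow> nat set \<Rightarrow> sample \<Rightarrow> nat \<Rightarrow> real \<Rightarrow> nat \<Rightarrow> real \<Rightarrow> nat" where
  "khat_rep2 \<kappa> g C U \<omega> j t k s = \<kappa> ((score_vec g (C \<union> U) \<omega>)(j := t, k := s))"

definition sel_u :: "((nat \<Rightarrow> real) \<Rightarrow> nat) \<Rightarrow> ((nat \<Rightarrow> real) \<Rightarrow> real) \<Rightarrow> nat set \<Rightarrow> nat set \<Rightarrow> sample \<Rightarrow> nat set" where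
  "sel_u \<kappa> g C U \<omega> = {j \<in> U. score g \<omega> j \<le> kth_smallest U (score g \<omega>) (khat \<kappa> g C U \<omega>)}"

definition sel_c_plus :: "((nat \<Rightarrow> real) \<Rightarrow> nat) \<Rightarrow> ((nat \<Rightarrow> real) \<Rightarrow> real) \<Rightarrow> nat set \<Rightarrow> nat set \<Rightarrow> sample \<Rightarrow> nat set" where
  "sel_c_plus \<kappa> g C U \<omega> = {i \<in> C. score g \<omega> i \<le> kth_smallest U (score g \<omega>) (khat \<kappa> g C U \<omega> + 1)}"

text \<open>Miscoverage: Y_j notin PI_j = [muhat(X_j) - Q, muhat(X_j) + Q] iff R_j > Q.\<close>
definition fcp :: "real \<Rightarrow> ((nat \<Rightarrow> real) \<Rightarrow> real) \<Rightarrow> ((nat \<Rightarrow> real) \<Rightarrow> real) \<Rightarrow> ((nat \<Rightarrow> real) \<Rightarrow> nat) \<Rightarrow> nat set \<Rightarrow> nat set \<Rightarrow> sample \<Rightarrow> real" where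
  "fcp \<alpha> mu g \<kappa> C U \<omega> =
     (let S = sel_u \<kappa> g C U \<omega>;
          Q = conf_quantile \<alpha> (sel_c_plus \<kappa> g C U \<omega>) (resid mu \<omega>)
      in real (card {j \<in> S. ereal (resid mu \<omega> j) > Q}) / real (max (card S) 1))"

definition FCR :: "point measure \<Rightarrow> real \<Rightarrow> ((nat \<Rightarrow> real) \<Rightarrow> real) \<Rightarrow> ((nat \<Rightarrow> real) \<Rightarrow> real) \<Rightarrow> ((nat \<Rightarrow> real) \<Rightarrow> nat) \<Rightarrow> nat set \<Rightarrow> nat set \<Rightarrow> real" where
  "FCR P \<alpha> mu g \<kappa> C U = (\<integral>\<omega>. fcp \<alpha> mu g \<kappa> C U \<omega> \<partial>(\<Pi>\<^sub>M i\<in>C \<union> U. P))"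

end

theory Submission
  imports Defs
begin

text \<open>
  Write \<open>h\<^sub>j\<close> for the threshold computed with \<open>T\<^sub>j\<close> replaced by \<open>t\<^sub>u\<close>. For a selected \<open>j\<close> it equals the
  true threshold, and both \<open>j \<in> S\<^sub>u\<close> and the calibration set are then decided by comparing ranks within
  \<open>U - {j}\<close> with \<open>h\<^sub>j\<close>; at most \<open>I\<^sub>u\<close> unselected indices pass that comparison. So \<open>FCP - \<alpha>\<close> is
  a sum of terms \<open>W\<^sub>j\<close> up to \<open>I\<^sub>u / (\<gamma> m)\<close>.

  The law of the data is invariant under exchanging \<open>j\<close> with any \<open>k \<in> C\<close>, hence \<open>(n + 1) E W\<^sub>j\<close> is the
  expected sum of the exchanged terms. If \<open>h\<^sub>j\<close> were unaffected by the exchange, that sum would be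
  \<open>(b - \<lceil>(1 - \<alpha>) b\<rceil> - \<alpha> b) / h\<^sub>j\<close> for some \<open>b\<close>, that is \<open>O(1 / h\<^sub>j)\<close>. Comparing with the
  double replacement shows that the exchange moves \<open>h\<^sub>j\<close> by at most \<open>I\<^sub>c\<close>; this alters only terms of
  points whose score lies in a window of \<open>2 I\<^sub>c\<close> consecutive test scores, or whose residual rank is
  within the number \<open>D\<close> of such points of the quantile.

  On the scale of the distribution function of the scores, all gaps between consecutive test scores are
  \<open>O(log m / m)\<close> outside an event of probability \<open>1 / m\<close>, and an exponential moment bound for the
  number of calibration points in a short interval gives \<open>E D = O(log n + n I\<^sub>c log m / m)\<close>.
\<close>

section \<open>Ranks and the exchanged sum\<close>

text \<open>In the sorted list the entries below \<open>x\<close> form an initial segment, whose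
  length is less than \<open>r\<close> exactly if the entry at position \<open>r - 1\<close> is not
  in it. Ties do no harm. Selection and conformal quantiles both become counting conditions in this
  way.\<close>

lemma le_kth_smallest_iff:
  assumes "finite A" "1 \<le> r" "r \<le> card A"
  shows "x \<le> kth_smallest A f r \<longleftrightarrow> card {a \<in> A. f a < x} < r"
proof -
  define xs where "xs = sort (map f (sorted_list_of_set A))"
  have len: "length xs = card A" and srt: "sorted xs"
    by (simp_all add: xs_def)
  have "length (filter (\<lambda>y. y < x) xs) = length (filter (\<lambda>y. y < x) (map f (sorted_list_of_set A)))"
    unfolding xs_def by (metis mset_filter mset_sort size_mset)
  also have "\<dots> = length (filter (\<lambda>a. f a < x) (sorted_list_of_set A))"
    by (simp add: filter_map o_def)
  also have "\<dots> = card (set (filter (\<lambda>a. f a < x) (sorted_list_of_set A)))"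
    by (rule distinct_card[symmetric]) simp
  also have "\<dots> = card {a \<in> A. f a < x}"
    using assms(1) by simp
  finally have "card {a \<in> A. f a < x} = card {i. i < length xs \<and> xs ! i < x}"
    by (simp add: length_filter_conv_card)
  moreover have "card {i. i < length xs \<and> xs ! i < x} < r" if "x \<le> xs ! (r - 1)"
  proof -
    have "{i. i < length xs \<and> xs ! i < x} \<subseteq> {..<r - 1}"
    proof safe
      fix i assume "i < length xs" "xs ! i < x"
      then show "i < r - 1"
        using that sorted_nth_mono[OF srt, of "r - 1" i] by (force simp: not_le[symmetric])
    qed
    then have "card {i. i < length xs \<and> xs ! i < x} \<le> r - 1"
      using card_mono[OF finite_lessThan] by fastforce
    then show ?thesis using assms by simp
  qed
  moreover have "r \<le> card {i. i < length xs \<and> xs ! i < x}" if "\<not> x \<le> xs ! (r - 1)"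
  proof -
    have "{..<r} \<subseteq> {i. i < length xs \<and> xs ! i < x}"
    proof safe
      fix i assume i: "i < r"
      then show "i < length xs" using assms len by simp
      have "xs ! i \<le> xs ! (r - 1)"
        using i assms len by (intro sorted_nth_mono[OF srt]) auto
      then show "xs ! i < x" using that by simp
    qed
    then have "card {..<r} \<le> card {i. i < length xs \<and> xs ! i < x}"
      by (intro card_mono) auto
    then show ?thesis by simp
  qed
  ultimately show ?thesis
    unfolding kth_smallest_def xs_def[symmetric] by linarith
qed

text \<open>The index is a ceiling of a positive number, so \<open>nat\<close> loses nothing and it
  is at least 1. If it exceeds \<open>card S\<close>, the quantile is infinite and the count cannot
  reach the index either, so both sides are false.\<close>

lemma conf_quantile_less_iff:
  assumes "finite S" "0 < \<alpha>" "\<alpha> < 1"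
  shows "conf_quantile \<alpha> S f < ereal x \<longleftrightarrow>
    \<lceil>(1 - \<alpha>) * (real (card S) + 1)\<rceil> \<le> int (card {b \<in> S. f b < x})"
proof -
  define k where "k = nat \<lceil>(1 - \<alpha>) * (real (card S) + 1)\<rceil>"
  have "0 < (1 - \<alpha>) * (real (card S) + 1)" using assms by (simp add: add_nonneg_pos)
  then have "1 \<le> \<lceil>(1 - \<alpha>) * (real (card S) + 1)\<rceil>" by linarith
  then have k: "int k = \<lceil>(1 - \<alpha>) * (real (card S) + 1)\<rceil>" "1 \<le> k" unfolding k_def by linarith+
  show ?thesis
  proof (cases "k > card S")
    case True
    have "card {b \<in> S. f b < x} \<le> card S" using assms(1) by (intro card_mono) auto
    then show ?thesis using True by (simp add: conf_quantile_def k_def[symmetric] k(1)[symmetric])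
  next
    case False
    then show ?thesis using le_kth_smallest_iff[OF assms(1) k(2), of x f]
      by (auto simp: conf_quantile_def k_def[symmetric] k(1)[symmetric] not_le[symmetric] not_less)
  qed
qed

lemma inj_on_rank:
  fixes f :: "'a \<Rightarrow> 'b::linorder"
  assumes "finite B" "inj_on f B"
  shows "inj_on (\<lambda>k. card {i \<in> B. f i < f k}) B"
proof -
  have less: "card {i \<in> B. f i < f x} < card {i \<in> B. f i < f y}" if "x \<in> B" "f x < f y" for x y
    using that assms(1) by (intro psubset_card_mono) (auto intro: less_trans)
  show ?thesis
  proof (rule inj_onI)
    fix x y assume xy: "x \<in> B" "y \<in> B" "card {i \<in> B. f i < f x} = card {i \<in> B. f i < f y}"
    then have "f x = f y" using less[of x y] less[of y x] by (metis less_irrefl linorder_neqE)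
    then show "x = y" using assms(2) xy by (auto dest: inj_onD)
  qed
qed

lemma rank_less_card:
  fixes f :: "'a \<Rightarrow> 'b::linorder"
  assumes "finite B" "k \<in> B"
  shows "card {i \<in> B. f i < f k} < card B"
  using assms by (intro psubset_card_mono) auto

lemma rank_image:
  fixes f :: "'a \<Rightarrow> 'b::linorder"
  assumes "finite B" "inj_on f B"
  shows "(\<lambda>k. card {i \<in> B. f i < f k}) ` B = {..<card B}"
proof (rule card_subset_eq)
  show "(\<lambda>k. card {i \<in> B. f i < f k}) ` B \<subseteq> {..<card B}"
    using rank_less_card[OF assms(1)] by auto
qed (simp_all add: card_image[OF inj_on_rank[OF assms]])

text \<open>Distinct values take each of the ranks 0 up to \<open>card B - 1\<close> once, so
  counting elements by rank is counting ranks.\<close>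

lemma card_rank_vimage:
  fixes f :: "'a \<Rightarrow> 'b::linorder"
  assumes "finite B" "inj_on f B" "X \<subseteq> {..<card B}"
  shows "card {k \<in> B. card {i \<in> B. f i < f k} \<in> X} = card X"
proof -
  let ?r = "\<lambda>k. card {i \<in> B. f i < f k}"
  have "?r ` {k \<in> B. ?r k \<in> X} = X"
  proof (rule set_eqI, rule iffI)
    fix x assume "x \<in> X"
    then have "x \<in> ?r ` B" using assms(3) by (simp only: rank_image[OF assms(1,2)] subset_iff)
    then show "x \<in> ?r ` {k \<in> B. ?r k \<in> X}" using \<open>x \<in> X\<close> by fast
  qed fast
  moreover have "inj_on ?r {k \<in> B. ?r k \<in> X}"
    using inj_on_rank[OF assms(1,2)] by (rule inj_on_subset) auto
  ultimately show ?thesis using card_image[of ?r "{k \<in> B. ?r k \<in> X}"] by (simp only:)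
qed

lemma card_rank_vimage_le:
  fixes f :: "'a \<Rightarrow> 'b::linorder"
  assumes "finite B" "inj_on f B" "finite X"
  shows "card {k \<in> B. card {i \<in> B. f i < f k} \<in> X} \<le> card X"
proof -
  have "{k \<in> B. card {i \<in> B. f i < f k} \<in> X} = {k \<in> B. card {i \<in> B. f i < f k} \<in> X \<inter> {..<card B}}"
    using rank_less_card[OF assms(1)] by auto
  then have "card {k \<in> B. card {i \<in> B. f i < f k} \<in> X} = card (X \<inter> {..<card B})"
    using card_rank_vimage[OF assms(1,2), of "X \<inter> {..<card B}"] by simp
  then show ?thesis using assms(3) by (simp add: card_mono)
qed

section \<open>Terms of the exchanged sum and the effect of shifting the threshold\<close>

definition below :: "('i \<Rightarrow> nat) \<Rightarrow> 'i set \<Rightarrow> nat \<Rightarrow> 'i set" where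
  "below l B h = {i \<in> B. l i < h}"

text \<open>Since \<open>k\<close> belongs to \<open>S\<close>, this says that \<open>R k\<close> lies above the conformal quantile of the
  residuals over \<open>S - {k}\<close>; it is symmetric in the elements of \<open>S\<close>.\<close>

definition exceeds :: "real \<Rightarrow> ('i \<Rightarrow> real) \<Rightarrow> 'i set \<Rightarrow> 'i \<Rightarrow> bool" where
  "exceeds \<alpha> R S k \<longleftrightarrow> \<lceil>(1 - \<alpha>) * real (card S)\<rceil> \<le> int (card {i \<in> S. R i < R k})"

text \<open>\<open>h\<close> is at once the rank cut-off for selection and the number of selections
  by which the centred miscoverage indicator is divided. For \<open>h = 0\<close> the first branch
  cannot occur.\<close>

definition excess :: "real \<Rightarrow> ('i \<Rightarrow> nat) \<Rightarrow> ('i \<Rightarrow> real) \<Rightarrow> 'i set \<Rightarrow> nat \<Rightarrow> 'i \<Rightarrow> real" where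
  "excess \<alpha> l R B h k =
     (if l k < h then (of_bool (exceeds \<alpha> R (below l B h) k) - \<alpha>) / real h else 0)"

lemma abs_excess_le:
  assumes "0 < \<alpha>" "\<alpha> < 1"
  shows "\<bar>excess \<alpha> l R B h k\<bar> \<le> of_bool (l k < h) / real h"
  using assms by (auto simp: excess_def divide_right_mono)

lemma ceiling_mult_add_le:
  assumes "0 < \<alpha>" "\<alpha> < 1"
  shows "\<lceil>(1 - \<alpha>) * real (b + d)\<rceil> \<le> \<lceil>(1 - \<alpha>) * real b\<rceil> + int d"
proof -
  have "(1 - \<alpha>) * real (b + d) \<le> (1 - \<alpha>) * real b + real d"
    using assms by (simp add: algebra_simps)
  then have "\<lceil>(1 - \<alpha>) * real (b + d)\<rceil> \<le> \<lceil>(1 - \<alpha>) * real b + real d\<rceil>" by (rule ceiling_mono)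
  then show ?thesis using ceiling_add_of_int[of "(1 - \<alpha>) * real b" "int d"] by simp
qed

text \<open>Enlarging \<open>S\<close> to \<open>S'\<close> raises both the rank of
  \<open>R k\<close> and the quantile index by between 0 and \<open>d\<close>. Their difference
  moves by at most \<open>d\<close>, so it changes sign only if it lies within \<open>d\<close> of
  zero for both sets.\<close>

lemma exceeds_nested:
  assumes fin: "finite S'" and sub: "S \<subseteq> S'" and d: "card (S' - S) \<le> d" and \<alpha>: "0 < \<alpha>" "\<alpha> < 1"
  shows "exceeds \<alpha> R S k \<noteq> exceeds \<alpha> R S' k \<Longrightarrow>
      \<bar>int (card {i \<in> S. R i < R k}) - \<lceil>(1 - \<alpha>) * real (card S)\<rceil>\<bar> \<le> int d"
    and "exceeds \<alpha> R S k \<noteq> exceeds \<alpha> R S' k \<Longrightarrow>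
      \<bar>int (card {i \<in> S'. R i < R k}) - \<lceil>(1 - \<alpha>) * real (card S')\<rceil>\<bar> \<le> int d"
proof -
  have finS: "finite S" using fin sub by (rule finite_subset[rotated])
  have c: "card S' = card S + card (S' - S)"
    using card_Diff_subset[OF finS sub] card_mono[OF fin sub] by simp
  have "{i \<in> S'. R i < R k} = {i \<in> S. R i < R k} \<union> {i \<in> S' - S. R i < R k}" using sub by auto
  then have c2: "card {i \<in> S'. R i < R k} = card {i \<in> S. R i < R k} + card {i \<in> S' - S. R i < R k}"
    by (simp only:) (rule card_Un_disjoint; use fin finS in force)
  have c3: "card {i \<in> S' - S. R i < R k} \<le> card (S' - S)" using fin by (intro card_mono) auto
  have q1: "\<lceil>(1 - \<alpha>) * real (card S')\<rceil> \<le> \<lceil>(1 - \<alpha>) * real (card S)\<rceil> + int (card (S' - S))"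
    using ceiling_mult_add_le[OF \<alpha>, of "card S" "card (S' - S)"] c by simp
  have q2: "\<lceil>(1 - \<alpha>) * real (card S)\<rceil> \<le> \<lceil>(1 - \<alpha>) * real (card S')\<rceil>"
    using c \<alpha> by (intro ceiling_mono mult_left_mono) auto
  show "\<bar>int (card {i \<in> S. R i < R k}) - \<lceil>(1 - \<alpha>) * real (card S)\<rceil>\<bar> \<le> int d"
    if "exceeds \<alpha> R S k \<noteq> exceeds \<alpha> R S' k"
    using that c2 c3 q1 q2 d unfolding exceeds_def by (cases "exceeds \<alpha> R S k") (auto simp: exceeds_def)
  show "\<bar>int (card {i \<in> S'. R i < R k}) - \<lceil>(1 - \<alpha>) * real (card S')\<rceil>\<bar> \<le> int d"
    if "exceeds \<alpha> R S k \<noteq> exceeds \<alpha> R S' k"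
    using that c2 c3 q1 q2 d unfolding exceeds_def by (cases "exceeds \<alpha> R S k") (auto simp: exceeds_def)
qed

text \<open>With a common threshold, the exceeding elements are those of residual rank at least
  \<open>q\<close> in \<open>S\<close>. Since residuals are distinct there are
  \<open>card S - q\<close> of them, and rounding up in \<open>q\<close> moves this number away from
  \<alpha> times \<open>card S\<close> by at most 1.\<close>

lemma sum_excess_le:
  assumes fin: "finite B" and inj: "inj_on R B" and \<alpha>: "0 < \<alpha>" "\<alpha> < 1"
  shows "\<bar>\<Sum>k\<in>B. excess \<alpha> l R B h k\<bar> \<le> 1 / real h"
proof -
  define S where "S = below l B h"
  define q where "q = \<lceil>(1 - \<alpha>) * real (card S)\<rceil>"
  have S: "finite S" "S \<subseteq> B" "inj_on R S"
    using fin inj by (auto simp: S_def below_def intro: inj_on_subset)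
  have "0 \<le> (1 - \<alpha>) * real (card S)" using \<alpha> by simp
  then have q0: "0 \<le> q" unfolding q_def by linarith
  have "(1 - \<alpha>) * real (card S) \<le> real (card S)" using \<alpha> by (simp add: mult_left_le_one_le)
  then have q1: "q \<le> int (card S)" by (simp add: q_def ceiling_le_iff)
  have "(\<Sum>k\<in>B. excess \<alpha> l R B h k) = (\<Sum>k\<in>S. (of_bool (exceeds \<alpha> R S k) - \<alpha>) / real h)"
    using fin S by (intro sum.mono_neutral_cong_right) (auto simp: excess_def S_def below_def)
  also have "\<dots> = ((\<Sum>k\<in>S. of_bool (exceeds \<alpha> R S k)) - real (card S) * \<alpha>) / real h"
    by (simp add: sum_divide_distrib[symmetric] sum_subtractf)
  also have "(\<Sum>k\<in>S. of_bool (exceeds \<alpha> R S k)) = real (card {k \<in> S. exceeds \<alpha> R S k})"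
    using S by (simp add: sum.If_cases of_bool_def Int_def)
  also have "{k \<in> S. exceeds \<alpha> R S k} = {k \<in> S. card {i \<in> S. R i < R k} \<in> {nat q..<card S}}"
    using rank_less_card[OF S(1)] q0 by (auto simp: exceeds_def q_def[symmetric])
  also have "card \<dots> = card S - nat q"
    by (subst card_rank_vimage[OF S(1,3)]) auto
  finally have eq: "(\<Sum>k\<in>B. excess \<alpha> l R B h k) = (real (card S - nat q) - real (card S) * \<alpha>) / real h" .
  have "real (card S - nat q) = real (card S) - real_of_int q" using q0 q1 by (simp add: of_nat_diff)
  moreover have "(1 - \<alpha>) * real (card S) \<le> real_of_int q" "real_of_int q < (1 - \<alpha>) * real (card S) + 1"
    unfolding q_def by linarith+
  ultimately have "\<bar>real (card S - nat q) - real (card S) * \<alpha>\<bar> \<le> 1"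
    by (simp add: algebra_simps abs_le_iff)
  then show ?thesis unfolding eq abs_divide by (simp add: divide_right_mono)
qed

lemma abs_diff_inverse_le:
  fixes M a b c :: real
  assumes "0 < M" "M \<le> a" "M \<le> b" "\<bar>a - b\<bar> \<le> c"
  shows "\<bar>1 / a - 1 / b\<bar> \<le> c / M\<^sup>2"
proof -
  have "1 / a - 1 / b = (b - a) / (a * b)" using assms by (simp add: field_simps)
  then have "\<bar>1 / a - 1 / b\<bar> = \<bar>a - b\<bar> / (a * b)" using assms by (simp add: abs_mult abs_minus_commute)
  also have "\<dots> \<le> c / (M * M)" using assms by (intro frac_le mult_mono) auto
  finally show ?thesis by (simp add: power2_eq_square)
qed

text \<open>Compare with the sum for the fixed threshold \<open>h\<close>. \<open>D\<close> holds
  the points whose rank comparison may flip, \<open>E\<close> those whose residual rank is so close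
  to the quantile index that \<open>exceeds\<close> may flip. At these a term changes by at most
  \<open>1 / M\<close>; elsewhere only the denominator varies, which costs
  \<open>I / M^2\<close>.\<close>

lemma sum_excess_perturbed_le:
  fixes M :: real
  assumes fin: "finite B" and inj: "inj_on R B" and \<alpha>: "0 < \<alpha>" "\<alpha> < 1"
    and M: "0 < M" "M \<le> real h"
    and h': "\<And>k. k \<in> B \<Longrightarrow> M \<le> real (h' k) \<and> h' k \<le> h + I \<and> h \<le> h' k + I"
  shows "\<bar>\<Sum>k\<in>B. excess \<alpha> l R B (h' k) k\<bar> \<le>
    (1 + 5 * real (card {i \<in> B. h \<le> l i + I \<and> l i < h + I})) / M + real (card B) * real I / M\<^sup>2"
proof -
  define D where "D = {i \<in> B. h \<le> l i + I \<and> l i < h + I}"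
  define S where "S = below l B h"
  define q where "q = \<lceil>(1 - \<alpha>) * real (card S)\<rceil>"
  define E where "E = {k \<in> S. \<bar>int (card {i \<in> S. R i < R k}) - q\<bar> \<le> int (card D)}"
  \<comment> \<open>\<open>E\<close> enters only if \<open>D\<close> is nonempty; then the
    \<open>+ 1\<close> in the bound for its size is absorbed into a multiple of
    \<open>card D\<close>. If \<open>D\<close> is empty, all thresholds cut out the same set and no
    verdict changes.\<close>
  define X where "X = D \<union> (if D = {} then {} else E)"
  have finD: "finite D" using fin by (simp add: D_def)
  have S: "finite S" "S \<subseteq> B" "inj_on R S"
    using fin inj by (auto simp: S_def below_def intro: inj_on_subset)
  have "0 \<le> (1 - \<alpha>) * real (card S)" using \<alpha> by simp
  then have q0: "0 \<le> q" unfolding q_def by linarith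
  have "E \<subseteq> {k \<in> S. card {i \<in> S. R i < R k} \<in> {nat (q - int (card D))..nat (q + int (card D))}}"
    unfolding E_def by auto
  then have "card E \<le> card {k \<in> S. card {i \<in> S. R i < R k} \<in> {nat (q - int (card D))..nat (q + int (card D))}}"
    using S by (intro card_mono) auto
  also have "\<dots> \<le> card {nat (q - int (card D))..nat (q + int (card D))}"
    by (intro card_rank_vimage_le S) auto
  also have "\<dots> \<le> 2 * card D + 1" using q0 by simp
  finally have cardE: "card E \<le> 2 * card D + 1" .
  have cardX: "card X \<le> 5 * card D"
  proof (cases "D = {}")
    case False
    then have "1 \<le> card D" using finD by (simp add: Suc_le_eq card_gt_0_iff)
    then show ?thesis using False cardE card_Un_le[of D E] by (simp add: X_def)
  qed (simp add: X_def)
  have XB: "X \<subseteq> B" using S by (auto simp: X_def D_def E_def split: if_splits)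
  have diff: "\<bar>excess \<alpha> l R B (h' k) k - excess \<alpha> l R B h k\<bar> \<le> real I / M\<^sup>2 + of_bool (k \<in> X) / M"
    if k: "k \<in> B" for k
  proof -
    define S' where "S' = below l B (h' k)"
    have hk: "M \<le> real (h' k)" "h' k \<le> h + I" "h \<le> h' k + I" using h'[OF k] by auto
    have inv: "\<bar>1 / real (h' k) - 1 / real h\<bar> \<le> real I / M\<^sup>2"
      using hk M by (intro abs_diff_inverse_le) auto
    have nn: "0 \<le> real I / M\<^sup>2" by simp
    have finS': "finite S'" using fin by (simp add: S'_def below_def)
    have SD: "S' - S \<subseteq> D" "S - S' \<subseteq> D" using hk by (auto simp: S_def S'_def D_def below_def)
    \<comment> \<open>Both are sublevel sets of \<open>l\<close>, hence nested; the two conclusions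
      of \<open>exceeds_nested\<close> serve the two inclusions.\<close>
    have cases: "S \<subseteq> S' \<or> S' \<subseteq> S" by (auto simp: S_def S'_def below_def)
    show ?thesis
    proof (cases "k \<in> X")
      case True
      \<comment> \<open>Both values lie in one interval of length \<open>1 / M\<close>, which saves
        a factor 2 over adding their absolute bounds.\<close>
      have bounds: "- \<alpha> / M \<le> excess \<alpha> l R B a k \<and> excess \<alpha> l R B a k \<le> (1 - \<alpha>) / M"
        if "M \<le> real a" for a
      proof -
        have "- \<alpha> / M \<le> 0" "0 \<le> (1 - \<alpha>) / M" "0 \<le> (1 - \<alpha>) / real a" "- \<alpha> / real a \<le> 0"
          using M(1) \<alpha> that by auto
        moreover have "\<alpha> / real a \<le> \<alpha> / M" "(1 - \<alpha>) / real a \<le> (1 - \<alpha>) / M"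
          using M(1) \<alpha> that by (auto intro!: frac_le)
        ultimately show ?thesis by (auto simp: excess_def of_bool_def)
      qed
      have "(1 - \<alpha>) / M - (- \<alpha> / M) = 1 / M" by (simp add: diff_divide_distrib)
      then have "\<bar>excess \<alpha> l R B (h' k) k - excess \<alpha> l R B h k\<bar> \<le> 1 / M"
        using bounds[OF hk(1)] bounds[OF M(2)] unfolding abs_le_iff by linarith
      with nn have "\<bar>excess \<alpha> l R B (h' k) k - excess \<alpha> l R B h k\<bar> \<le> real I / M\<^sup>2 + 1 / M"
        by linarith
      then show ?thesis using True by simp
    next
      case False
      then have kD: "k \<notin> D" by (auto simp: X_def)
      then have iff: "l k < h' k \<longleftrightarrow> l k < h" using hk k by (auto simp: D_def)
      have "exceeds \<alpha> R S' k = exceeds \<alpha> R S k" if "l k < h"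
      proof (rule ccontr)
        assume ne: "exceeds \<alpha> R S' k \<noteq> exceeds \<alpha> R S k"
        then have "S' \<noteq> S" by auto
        then have "D \<noteq> {}" using SD by auto
        then have "k \<notin> E" using False by (auto simp: X_def)
        moreover have "k \<in> S" using that k by (simp add: S_def below_def)
        moreover have "\<bar>int (card {i \<in> S. R i < R k}) - q\<bar> \<le> int (card D)"
          using cases
        proof
          assume "S \<subseteq> S'"
          then show ?thesis unfolding q_def
            using exceeds_nested(1)[OF finS' _ card_mono[OF finD SD(1)] \<alpha>] ne by metis
        next
          assume "S' \<subseteq> S"
          then show ?thesis unfolding q_def
            using exceeds_nested(2)[OF S(1) _ card_mono[OF finD SD(2)] \<alpha>] ne by metis
        qed
        ultimately show False by (simp add: E_def)
      qed
      then have "\<bar>excess \<alpha> l R B (h' k) k - excess \<alpha> l R B h k\<bar> \<le>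
        \<bar>(of_bool (exceeds \<alpha> R S k) - \<alpha>) * (1 / real (h' k) - 1 / real h)\<bar>"
        using iff by (cases "l k < h")
          (simp_all add: excess_def S_def S'_def right_diff_distrib)
      also have "\<dots> \<le> 1 * \<bar>1 / real (h' k) - 1 / real h\<bar>"
        unfolding abs_mult using \<alpha> by (intro mult_right_mono) (auto simp: of_bool_def)
      finally show ?thesis using inv False by simp
    qed
  qed
  have "\<bar>(\<Sum>k\<in>B. excess \<alpha> l R B (h' k) k) - (\<Sum>k\<in>B. excess \<alpha> l R B h k)\<bar> \<le>
      (\<Sum>k\<in>B. real I / M\<^sup>2 + of_bool (k \<in> X) / M)"
    unfolding sum_subtractf[symmetric] by (intro order_trans[OF sum_abs] sum_mono diff)
  also have "\<dots> = real (card B) * real I / M\<^sup>2 + real (card X) / M"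
  proof -
    have "(\<Sum>k\<in>B. of_bool (k \<in> X)) = real (card X)"
      using fin XB by (simp add: sum.If_cases of_bool_def Int_absorb1)
    then show ?thesis by (simp add: sum.distrib sum_divide_distrib[symmetric])
  qed
  also have "\<dots> \<le> real (card B) * real I / M\<^sup>2 + 5 * real (card D) / M"
    using cardX M by (intro add_left_mono divide_right_mono) auto
  finally have "\<bar>(\<Sum>k\<in>B. excess \<alpha> l R B (h' k) k) - (\<Sum>k\<in>B. excess \<alpha> l R B h k)\<bar> \<le>
      real (card B) * real I / M\<^sup>2 + 5 * real (card D) / M" .
  moreover have "\<bar>\<Sum>k\<in>B. excess \<alpha> l R B h k\<bar> \<le> 1 / M"
    using sum_excess_le[OF fin inj \<alpha>, of l h] M by (smt (verit) frac_le)
  ultimately show ?thesis unfolding D_def[symmetric] add_divide_distrib by linarith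
qed

section \<open>Gaps between scores\<close>

text \<open>Walk upwards from \<open>y\<close>: every step reaches a further score and raises
  \<open>F\<close> by at most \<open>x\<close>; after at most \<open>c\<close> scores below
  \<open>t\<close> one more step gets past \<open>t\<close>. Near the top, where
  \<open>y + x\<close> is at least 1, the bound \<open>F t\<close> \<le> 1 ends the walk, so no
  score has to be found there.\<close>

lemma le_by_small_gaps:
  fixes T :: "'i \<Rightarrow> real" and F :: "real \<Rightarrow> real" and x :: real
  assumes fin: "finite V" and mono: "mono F" and F1: "\<And>t. F t \<le> 1" and x: "0 \<le> x"
    and gap: "\<And>y. y \<in> insert 0 ((\<lambda>v. F (T v)) ` V) \<Longrightarrow> y + x < 1 \<Longrightarrow> \<exists>v\<in>V. y < F (T v) \<and> F (T v) \<le> y + x"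
    and y: "y \<in> insert 0 ((\<lambda>v. F (T v)) ` V)"
    and c: "card {v \<in> V. y < F (T v) \<and> T v < t} \<le> c"
  shows "F t \<le> y + (real c + 1) * x"
  using y c
proof (induction c arbitrary: y)
  case (0 y)
  show ?case
  proof (cases "y + x < 1")
    case True
    then obtain v where v: "v \<in> V" "y < F (T v)" "F (T v) \<le> y + x" using gap 0 by blast
    then have "\<not> T v < t" using 0 fin by auto
    then have "F t \<le> F (T v)" using mono by (simp add: monoD)
    then show ?thesis using v by simp
  next
    case False
    then show ?thesis using F1[of t] by simp
  qed
next
  case (Suc c y)
  have nn: "0 \<le> real (Suc c) * x" using x by simp
  have eq: "y + (real (Suc c) + 1) * x = (y + x) + real (Suc c) * x" by (simp add: algebra_simps)
  show ?case
  proof (cases "y + x < 1")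
    case True
    then obtain v where v: "v \<in> V" "y < F (T v)" "F (T v) \<le> y + x" using gap Suc by blast
    show ?thesis
    proof (cases "T v < t")
      case True
      have "{w \<in> V. F (T v) < F (T w) \<and> T w < t} \<subset> {w \<in> V. y < F (T w) \<and> T w < t}"
        using v True by (intro psubsetI subsetI) (auto simp: set_eq_iff)
      then have "card {w \<in> V. F (T v) < F (T w) \<and> T w < t} < card {w \<in> V. y < F (T w) \<and> T w < t}"
        using fin by (intro psubset_card_mono) auto
      then have "F t \<le> F (T v) + (real c + 1) * x" using Suc.prems(2) v by (intro Suc.IH) auto
      then show ?thesis using v eq by (simp add: algebra_simps)
    next
      case False
      then have "F t \<le> F (T v)" using mono by (simp add: monoD)
      then show ?thesis using v eq nn by linarith
    qed
  next
    case False
    then show ?thesis using F1[of t] eq nn by linarith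
  qed
qed

text \<open>Start the walk at the largest \<open>F (T v)\<close> with \<open>T v < s\<close>, or at
  0 if there is none. Scores met before \<open>t\<close> are not below \<open>s\<close>, so there
  are at most \<open>c - 1\<close> of them and \<open>c\<close> steps suffice.\<close>

lemma close_ranks_close_values:
  fixes T :: "'i \<Rightarrow> real" and F :: "real \<Rightarrow> real" and x :: real
  assumes fin: "finite V" and mono: "mono F" and F: "\<And>t. 0 \<le> F t" "\<And>t. F t \<le> 1" and x: "0 \<le> x"
    and gap: "\<And>y. y \<in> insert 0 ((\<lambda>v. F (T v)) ` V) \<Longrightarrow> y + x < 1 \<Longrightarrow> \<exists>v\<in>V. y < F (T v) \<and> F (T v) \<le> y + x"
    and st: "s \<le> t" and c: "card {v \<in> V. T v < t} < card {v \<in> V. T v < s} + c"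
  shows "F t \<le> F s + real c * x"
proof -
  obtain c' where c': "c = Suc c'" using c st card_mono[of "{v \<in> V. T v < t}" "{v \<in> V. T v < s}"] fin
    by (cases c) (auto simp: subset_eq)
  obtain y where y: "y \<in> insert 0 ((\<lambda>v. F (T v)) ` V)" "y \<le> F s"
    "\<And>v. v \<in> V \<Longrightarrow> T v < s \<Longrightarrow> F (T v) \<le> y"
  proof (cases "{v \<in> V. T v < s} = {}")
    case True
    then show ?thesis using F by (intro that[of 0]) auto
  next
    case False
    define A where "A = (\<lambda>v. F (T v)) ` {v \<in> V. T v < s}"
    have A: "finite A" "A \<noteq> {}" using fin False by (auto simp: A_def)
    have "Max A \<in> A" using A by (rule Max_in)
    then obtain v where v: "v \<in> V" "T v < s" "Max A = F (T v)" unfolding A_def by auto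
    show ?thesis
    proof (rule that[of "Max A"])
      show "Max A \<in> insert 0 ((\<lambda>v. F (T v)) ` V)" using v by auto
      show "Max A \<le> F s" using v mono by (auto intro: monoD)
      show "F (T w) \<le> Max A" if "w \<in> V" "T w < s" for w
        using that A(1) by (intro Max_ge) (auto simp: A_def)
    qed
  qed
  have "{v \<in> V. y < F (T v) \<and> T v < t} \<subseteq> {v \<in> V. T v < t} - {v \<in> V. T v < s}"
    using y(3) by force
  then have "card {v \<in> V. y < F (T v) \<and> T v < t} \<le> card ({v \<in> V. T v < t} - {v \<in> V. T v < s})"
    using fin by (intro card_mono) auto
  also have "\<dots> = card {v \<in> V. T v < t} - card {v \<in> V. T v < s}"
    using fin st by (intro card_Diff_subset) auto
  also have "\<dots> \<le> c'" using c c' by simp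
  finally have "F t \<le> y + (real c' + 1) * x"
    by (intro le_by_small_gaps[OF fin mono F(2) x gap y(1)])
  then show ?thesis using y(2) c' by (simp add: add.commute)
qed

text \<open>The window depends on \<open>h\<close>, which may depend on the data. Its element
  \<open>k\<close> of lowest score serves as an anchor: the whole window lies within
  \<open>2 * I * x\<close> above it on the scale of \<open>F\<close>. Replacing the unknown anchor
  by a sum of exponentials over all of \<open>B\<close> leaves a right-hand side free of
  \<open>h\<close>.\<close>

lemma card_rank_window_le:
  fixes T :: "'i \<Rightarrow> real" and F :: "real \<Rightarrow> real" and x s :: real
  assumes fin: "finite V" "finite B" and mono: "mono F" and F: "\<And>t. 0 \<le> F t" "\<And>t. F t \<le> 1"
    and x: "0 \<le> x"
    and gap: "\<And>y. y \<in> insert 0 ((\<lambda>v. F (T v)) ` V) \<Longrightarrow> y + x < 1 \<Longrightarrow> \<exists>v\<in>V. y < F (T v) \<and> F (T v) \<le> y + x"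
    and s: "0 \<le> s"
  shows "real (card {i \<in> B. h \<le> card {v \<in> V. T v < T i} + I \<and> card {v \<in> V. T v < T i} < h + I})
    \<le> s + (\<Sum>k\<in>B. exp (real (card {i \<in> B. F (T k) \<le> F (T i) \<and> F (T i) \<le> F (T k) + real (2 * I) * x}) - s))"
    (is "real (card ?D) \<le> s + (\<Sum>k\<in>B. exp (real (card (?N k)) - s))")
proof (cases "?D = {}")
  case True
  then show ?thesis using s by (simp only: True) (simp add: sum_nonneg)
next
  case False
  have finD: "finite ?D" using fin by simp
  obtain k where k: "k \<in> ?D" "\<And>i. i \<in> ?D \<Longrightarrow> T k \<le> T i"
    using arg_min_if_finite[OF finD False, of T] by (metis (mono_tags, lifting) not_le)
  have "?D \<subseteq> ?N k"
  proof
    fix i assume i: "i \<in> ?D"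
    \<comment> \<open>Two ranks in the window differ by less than \<open>2 * I\<close>.\<close>
    have "F (T i) \<le> F (T k) + real (2 * I) * x"
      using i k(1) by (intro close_ranks_close_values[OF fin(1) mono F x gap k(2)[OF i]]) auto
    then show "i \<in> ?N k" using i k(2)[OF i] mono by (simp add: monoD)
  qed
  then have "real (card ?D) \<le> real (card (?N k))" using fin by (simp add: card_mono)
  also have "\<dots> \<le> s + exp (real (card (?N k)) - s)" using exp_ge_add_one_self[of "real (card (?N k)) - s"] by linarith
  also have "exp (real (card (?N k)) - s) \<le> (\<Sum>k\<in>B. exp (real (card (?N k)) - s))"
    using k(1) fin by (intro member_le_sum) auto
  finally show ?thesis by simp
qed

section \<open>Probability integral transform and uniform variables\<close>

text \<open>\<open>F\<close> may have flat pieces, so two levels are used. If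
  \<open>F t = w\<close>, the event \<open>T z\<close> \<le> \<open>t\<close> is contained in
  \<open>F (T z)\<close> \<le> \<open>w\<close> and contains \<open>F (T z)\<close> \<le>
  \<open>v\<close> for every \<open>v < w\<close>. Letting the auxiliary level tend to
  \<open>y\<close> gives both inequalities.\<close>

lemma (in prob_space) prob_cdf_transform_le:
  fixes T :: "'a \<Rightarrow> real"
  assumes T[measurable]: "T \<in> borel_measurable M" and cont: "\<And>t. prob {z \<in> space M. T z = t} = 0"
    and y: "0 \<le> y" "y \<le> 1"
  defines "F \<equiv> \<lambda>t. prob {z \<in> space M. T z \<le> t}"
  shows "prob {z \<in> space M. F (T z) \<le> y} = y"
proof -
  let ?D = "distr M borel T"
  interpret D: real_distribution ?D by simp
  have F_eq: "F = cdf ?D"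
    by (auto simp: F_def cdf_def2 measure_distr vimage_def fun_eq_iff intro!: arg_cong[where f=prob])
  have mono: "mono F" unfolding F_eq by (intro monoI D.cdf_nondecreasing)
  have [measurable]: "F \<in> borel_measurable borel" by (rule borel_measurable_mono[OF mono])
  have isc: "isCont F t" for t
  proof -
    have "measure ?D {t} = prob {z \<in> space M. T z = t}"
      by (auto simp: measure_distr vimage_def intro!: arg_cong[where f=prob])
    then show ?thesis unfolding F_eq D.isCont_cdf using cont by simp
  qed
  have ivt: "\<exists>t. F t = w" if "0 < w" "w < 1" for w
  proof -
    have "eventually (\<lambda>t. F t < w) at_bot"
      using order_tendstoD(2)[OF D.cdf_lim_at_bot that(1)] unfolding F_eq .
    then obtain a where a: "F a < w" by (auto simp: eventually_at_bot_linorder)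
    have "eventually (\<lambda>t. w < F t) at_top"
      using order_tendstoD(1)[OF D.cdf_lim_at_top_prob that(2)] unfolding F_eq .
    then obtain b where b: "w < F b" by (auto simp: eventually_at_top_linorder)
    have "a \<le> b" using a b mono by (meson less_le_trans linear monoD not_le less_trans)
    then show ?thesis using IVT[of F a w b] a b isc by auto
  qed
  have lower: "w \<le> prob {z \<in> space M. F (T z) \<le> w}" if w: "0 < w" "w < 1" for w
  proof -
    obtain t where t: "F t = w" using ivt[OF w] by auto
    have "prob {z \<in> space M. T z \<le> t} \<le> prob {z \<in> space M. F (T z) \<le> w}"
      using t mono by (intro finite_measure_mono) (auto dest: monoD)
    then show ?thesis using t by (simp add: F_def)
  qed
  have upper: "prob {z \<in> space M. F (T z) \<le> v} \<le> w" if w: "v < w" "0 < w" "w < 1" for v w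
  proof -
    obtain t where t: "F t = w" using ivt[OF w(2,3)] by auto
    have "T z \<le> t" if "F (T z) \<le> v" for z
      using that t w monoD[OF mono, of t "T z"] by linarith
    then have "prob {z \<in> space M. F (T z) \<le> v} \<le> prob {z \<in> space M. T z \<le> t}"
      by (intro finite_measure_mono) auto
    then show ?thesis using t by (simp add: F_def)
  qed
  show ?thesis
  proof (rule antisym)
    show "prob {z \<in> space M. F (T z) \<le> y} \<le> y"
    proof (cases "y = 1")
      case False
      then show ?thesis using y by (intro dense_ge_bounded[of y 1] upper) auto
    qed simp
    show "y \<le> prob {z \<in> space M. F (T z) \<le> y}"
    proof (cases "y = 0")
      case False
      have "w \<le> prob {z \<in> space M. F (T z) \<le> y}" if "0 < w" "w < y" for w
        using that y by (intro order_trans[OF lower[of w]] finite_measure_mono) auto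
      then show ?thesis using y False by (intro dense_le_bounded[of 0 y]) auto
    qed simp
  qed
qed

context prob_space
begin

context
  fixes u :: "'a \<Rightarrow> real"
  assumes u[measurable]: "u \<in> borel_measurable M"
    and unif: "\<And>y. 0 \<le> y \<Longrightarrow> y \<le> 1 \<Longrightarrow> prob {z \<in> space M. u z \<le> y} = y"
begin

lemma prob_uniform_Ioc:
  assumes "0 \<le> y" "0 \<le> x" "y + x \<le> 1"
  shows "prob {z \<in> space M. y < u z \<and> u z \<le> y + x} = x"
proof -
  have "{z \<in> space M. y < u z \<and> u z \<le> y + x} = {z \<in> space M. u z \<le> y + x} - {z \<in> space M. u z \<le> y}"
    by auto
  then show ?thesis using assms unif[of "y + x"] unif[of y]
    by (simp add: finite_measure_Diff subset_eq)
qed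

text \<open>The left endpoint is included by widening the interval to the left by an arbitrary
  \<open>e\<close>, truncated at 0. At \<open>y = 0\<close> the event is covered by
  \<open>u z\<close> \<le> \<open>p\<close>, and a right end beyond 1 is handled by the trivial
  bound 1.\<close>

lemma prob_uniform_Icc_le:
  assumes "0 \<le> y" "y \<le> 1" "0 \<le> p"
  shows "prob {z \<in> space M. y \<le> u z \<and> u z \<le> y + p} \<le> p"
proof (rule field_le_epsilon)
  fix e :: real assume e: "0 < e"
  define a where "a = max 0 (y - e)"
  show "prob {z \<in> space M. y \<le> u z \<and> u z \<le> y + p} \<le> p + e"
  proof (cases "y = 0")
    case True
    have "prob {z \<in> space M. y \<le> u z \<and> u z \<le> y + p} \<le> prob {z \<in> space M. u z \<le> y + p}"
      by (intro finite_measure_mono) auto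
    also have "\<dots> \<le> p"
    proof (cases "p \<le> 1")
      case False
      then show ?thesis by (intro order_trans[OF prob_le_1]) simp
    qed (use assms unif[of p] True in simp)
    finally show ?thesis using e by simp
  next
    case False
    have a: "0 \<le> a" "a < y" "y - e \<le> a" using assms e False by (auto simp: a_def)
    have "prob {z \<in> space M. y \<le> u z \<and> u z \<le> y + p} \<le> prob ({z \<in> space M. u z \<le> y + p} - {z \<in> space M. u z \<le> a})"
      using a by (intro finite_measure_mono) auto
    also have "\<dots> = prob {z \<in> space M. u z \<le> y + p} - prob {z \<in> space M. u z \<le> a}"
      using a assms by (intro finite_measure_Diff) auto
    also have "\<dots> \<le> y + p - a"
    proof -
      have "prob {z \<in> space M. u z \<le> y + p} \<le> y + p"
      proof (cases "y + p \<le> 1")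
        case False
        then show ?thesis by (intro order_trans[OF prob_le_1]) simp
      qed (use assms unif[of "y + p"] in simp)
      then show ?thesis using unif[of a] a assms by simp
    qed
    finally show ?thesis using a by simp
  qed
qed

end

section \<open>Conditioning on one coordinate of a product: counts and gaps\<close>

text \<open>Integrate over the other coordinates first: once \<open>\<omega> k\<close> is fixed, the
  factors are independent and each has integral at most \<open>c\<close>.\<close>

lemma nn_integral_PiM_prod_pair_le:
  fixes \<phi> :: "'a \<Rightarrow> 'a \<Rightarrow> ennreal"
  assumes fin: "finite I" and k: "k \<in> I" "k \<notin> A" and A: "A \<subseteq> I"
    and \<phi>[measurable]: "(\<lambda>(y, z). \<phi> y z) \<in> borel_measurable (M \<Otimes>\<^sub>M M)"
    and le: "\<And>y. y \<in> space M \<Longrightarrow> (\<integral>\<^sup>+z. \<phi> y z \<partial>M) \<le> c"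
  shows "(\<integral>\<^sup>+\<omega>. (\<Prod>i\<in>A. \<phi> (\<omega> k) (\<omega> i)) \<partial>(\<Pi>\<^sub>M i\<in>I. M)) \<le> c ^ card A"
proof -
  interpret product_sigma_finite "\<lambda>_. M" by standard
  define J where "J = I - {k}"
  have J: "finite J" "k \<notin> J" "I = insert k J" "A \<subseteq> J" using fin k A by (auto simp: J_def)
  have \<phi>1: "\<phi> y \<in> borel_measurable M" if "y \<in> space M" for y
    using measurable_Pair2[OF \<phi> that] by simp
  have [measurable]: "(\<lambda>\<omega>. \<Prod>i\<in>A. \<phi> (\<omega> k) (\<omega> i)) \<in> borel_measurable (\<Pi>\<^sub>M i\<in>insert k J. M)"
  proof (rule borel_measurable_prod_ennreal)
    fix i assume "i \<in> A"
    then have [measurable]: "(\<lambda>\<omega>. (\<omega> k, \<omega> i)) \<in> measurable (\<Pi>\<^sub>M i\<in>insert k J. M) (M \<Otimes>\<^sub>M M)"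
      using J by (intro measurable_Pair measurable_component_singleton) auto
    show "(\<lambda>\<omega>. \<phi> (\<omega> k) (\<omega> i)) \<in> borel_measurable (\<Pi>\<^sub>M i\<in>insert k J. M)"
      using measurable_compose[OF \<open>(\<lambda>\<omega>. (\<omega> k, \<omega> i)) \<in> _\<close> \<phi>] by simp
  qed
  have "(\<integral>\<^sup>+\<omega>. (\<Prod>i\<in>A. \<phi> (\<omega> k) (\<omega> i)) \<partial>(\<Pi>\<^sub>M i\<in>I. M)) =
      (\<integral>\<^sup>+y. (\<integral>\<^sup>+\<omega>. (\<Prod>i\<in>A. \<phi> ((fun_upd \<omega> k y) k) ((fun_upd \<omega> k y) i)) \<partial>(\<Pi>\<^sub>M i\<in>J. M)) \<partial>M)"
    unfolding J(3) by (rule product_nn_integral_insert_rev[OF J(1,2)]) measurable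
  also have "\<dots> \<le> (\<integral>\<^sup>+y. c ^ card A \<partial>M)"
  proof (rule nn_integral_mono)
    fix y assume y: "y \<in> space M"
    \<comment> \<open>Factors 1 outside \<open>A\<close> extend the product to all of
      \<open>J\<close>, where the integral of a product over coordinates factorises.\<close>
    have "(\<Prod>i\<in>A. \<phi> ((fun_upd \<omega> k y) k) ((fun_upd \<omega> k y) i)) = (\<Prod>i\<in>J. if i \<in> A then \<phi> y (\<omega> i) else 1)" for \<omega>
    proof -
      have "(\<Prod>i\<in>A. \<phi> ((fun_upd \<omega> k y) k) ((fun_upd \<omega> k y) i)) = (\<Prod>i\<in>A. \<phi> y (\<omega> i))"
        using k by (intro prod.cong) auto
      also have "\<dots> = (\<Prod>i\<in>J. if i \<in> A then \<phi> y (\<omega> i) else 1)"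
        using J by (intro prod.mono_neutral_cong_left) auto
      finally show ?thesis .
    qed
    then have "(\<integral>\<^sup>+\<omega>. (\<Prod>i\<in>A. \<phi> ((fun_upd \<omega> k y) k) ((fun_upd \<omega> k y) i)) \<partial>(\<Pi>\<^sub>M i\<in>J. M)) =
      (\<integral>\<^sup>+\<omega>. (\<Prod>i\<in>J. (\<lambda>i z. if i \<in> A then \<phi> y z else 1) i (\<omega> i)) \<partial>(\<Pi>\<^sub>M i\<in>J. M))" by simp
    also have "\<dots> = (\<Prod>i\<in>J. \<integral>\<^sup>+z. (if i \<in> A then \<phi> y z else 1) \<partial>M)"
      using J(1) \<phi>1[OF y] by (intro product_nn_integral_prod) auto
    also have "\<dots> = (\<Prod>i\<in>A. \<integral>\<^sup>+z. \<phi> y z \<partial>M)"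
      using J by (intro prod.mono_neutral_cong_right) (auto simp: emeasure_space_1)
    also have "\<dots> \<le> (\<Prod>i\<in>A. c)" using le[OF y] by (induction A rule: infinite_finite_induct) (auto intro: mult_mono)
    finally show "(\<integral>\<^sup>+\<omega>. (\<Prod>i\<in>A. \<phi> ((fun_upd \<omega> k y) k) ((fun_upd \<omega> k y) i)) \<partial>(\<Pi>\<^sub>M i\<in>J. M)) \<le> c ^ card A"
      by simp
  qed
  also have "\<dots> = c ^ card A" by (simp add: emeasure_space_1)
  finally show ?thesis .
qed

end

lemma sets_large_gap:
  assumes u[measurable]: "u \<in> borel_measurable M" and V: "finite V" "V \<subseteq> I"
  shows "{\<omega> \<in> space (\<Pi>\<^sub>M i\<in>I. M). \<exists>y\<in>insert (0::real) ((\<lambda>v. u (\<omega> v)) ` V). y + x < 1 \<and>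
    \<not> (\<exists>v\<in>V. y < u (\<omega> v) \<and> u (\<omega> v) \<le> y + x)} \<in> sets (\<Pi>\<^sub>M i\<in>I. M)"
proof -
  have um: "(\<lambda>\<omega>. u (\<omega> v)) \<in> borel_measurable (\<Pi>\<^sub>M i\<in>I. M)" if "v \<in> V" for v
    using that V by (intro measurable_compose[OF measurable_component_singleton[of v I "\<lambda>_. M"] u]) auto
  have gap: "Measurable.pred (\<Pi>\<^sub>M i\<in>I. M) (\<lambda>\<omega>. f \<omega> + x < 1 \<and> \<not> (\<exists>v\<in>V. f \<omega> < u (\<omega> v) \<and> u (\<omega> v) \<le> f \<omega> + x))"
    if "f \<in> borel_measurable (\<Pi>\<^sub>M i\<in>I. M)" for f
  proof -
    have less: "Measurable.pred (\<Pi>\<^sub>M i\<in>I. M) (\<lambda>\<omega>. a \<omega> < b \<omega>)"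
      if "a \<in> borel_measurable (\<Pi>\<^sub>M i\<in>I. M)" "b \<in> borel_measurable (\<Pi>\<^sub>M i\<in>I. M)" for a b :: "_ \<Rightarrow> real"
      unfolding pred_def using that by (rule borel_measurable_less)
    have le: "Measurable.pred (\<Pi>\<^sub>M i\<in>I. M) (\<lambda>\<omega>. a \<omega> \<le> b \<omega>)"
      if "a \<in> borel_measurable (\<Pi>\<^sub>M i\<in>I. M)" "b \<in> borel_measurable (\<Pi>\<^sub>M i\<in>I. M)" for a b :: "_ \<Rightarrow> real"
      unfolding pred_def using that by (rule borel_measurable_le)
    show ?thesis
      using V by (intro pred_intros_finite pred_intros_logic less le that um
          borel_measurable_add borel_measurable_const)
  qed
  have gapV: "Measurable.pred (\<Pi>\<^sub>M i\<in>I. M) (\<lambda>\<omega>. \<exists>w\<in>V. u (\<omega> w) + x < 1 \<and>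
      \<not> (\<exists>v\<in>V. u (\<omega> w) < u (\<omega> v) \<and> u (\<omega> v) \<le> u (\<omega> w) + x))"
    using V um by (intro pred_intros_finite gap)
  have bex: "(\<exists>y\<in>insert 0 (f ` V). Q y) \<longleftrightarrow> Q 0 \<or> (\<exists>w\<in>V. Q (f w))" for f and Q :: "real \<Rightarrow> bool"
    by blast
  show ?thesis
    unfolding bex using gap[of "\<lambda>_. 0", OF borel_measurable_const] gapV
    unfolding pred_def by (intro sets.sets_Collect_disj)
qed

context prob_space
begin

context
  fixes u :: "'a \<Rightarrow> real"
  assumes u[measurable]: "u \<in> borel_measurable M"
    and unif: "\<And>y. 0 \<le> y \<Longrightarrow> y \<le> 1 \<Longrightarrow> prob {z \<in> space M. u z \<le> y} = y"
    and u01: "\<And>z. 0 \<le> u z" "\<And>z. u z \<le> 1"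
begin

text \<open>The point \<open>k\<close> counts itself, which gives a factor \<open>exp 1\<close>.
  Given \<open>\<omega> k\<close>, the other points lie in the interval independently, each with
  probability at most \<open>p\<close>, and each contributes a mean of at most 1 + (e - 1) p \<le> 1
  + 2 p \<le> exp (2 p).\<close>

lemma nn_integral_exp_card_neighbours_le:
  fixes I B :: "nat set"
  assumes fin: "finite I" and B: "B \<subseteq> I" and k: "k \<in> B" and p: "0 \<le> p"
  shows "(\<integral>\<^sup>+\<omega>. ennreal (exp (real (card {i \<in> B. u (\<omega> k) \<le> u (\<omega> i) \<and> u (\<omega> i) \<le> u (\<omega> k) + p})))
      \<partial>(\<Pi>\<^sub>M i\<in>I. M)) \<le> ennreal (exp (1 + 2 * p * (real (card B) - 1)))"
proof -
  define A where "A = B - {k}"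
  define Q where "Q y z \<longleftrightarrow> u y \<le> u z \<and> u z \<le> u y + p" for y z
  define \<phi> where "\<phi> y z = ennreal (exp (of_bool (Q y z)))" for y z
  have finB: "finite B" using fin B by (rule finite_subset[rotated])
  have A: "finite A" "k \<notin> A" "A \<subseteq> I" "real (card A) = real (card B) - 1" "k \<in> I"
    using finB B k card_Suc_Diff1[OF finB k] by (auto simp: A_def simp del: card_Diff_insert)
  have [measurable]: "Measurable.pred (M \<Otimes>\<^sub>M M) (\<lambda>(y, z). Q y z)"
    unfolding Q_def by measurable
  have \<phi>: "(\<lambda>(y, z). \<phi> y z) \<in> borel_measurable (M \<Otimes>\<^sub>M M)"
    unfolding \<phi>_def Q_def of_bool_def by measurable
  have le: "(\<integral>\<^sup>+z. \<phi> y z \<partial>M) \<le> ennreal (exp (2 * p))" if y: "y \<in> space M" for y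
  proof -
    have [measurable]: "{z \<in> space M. Q y z} \<in> sets M" unfolding Q_def by measurable
    have e1: "exp 1 - 1 \<le> (2::real)" using exp_le by simp
    have "(\<integral>\<^sup>+z. \<phi> y z \<partial>M) = (\<integral>\<^sup>+z. 1 + ennreal (exp 1 - 1) * indicator {z \<in> space M. Q y z} z \<partial>M)"
    proof (rule nn_integral_cong)
      fix z assume "z \<in> space M"
      then show "\<phi> y z = 1 + ennreal (exp 1 - 1) * indicator {z \<in> space M. Q y z} z"
        using ennreal_plus[of 1 "exp 1 - 1"] by (auto simp: \<phi>_def indicator_def)
    qed
    also have "\<dots> = 1 + ennreal (exp 1 - 1) * emeasure M {z \<in> space M. Q y z}"
      by (subst nn_integral_add) (auto simp: emeasure_space_1 nn_integral_cmult_indicator)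
    also have "\<dots> = ennreal (1 + (exp 1 - 1) * prob {z \<in> space M. Q y z})"
      by (simp add: emeasure_eq_measure ennreal_mult' ennreal_plus)
    also have "\<dots> \<le> ennreal (exp (2 * p))"
    proof (rule ennreal_leI)
      have "prob {z \<in> space M. Q y z} \<le> p"
        unfolding Q_def using u unif u01 p by (intro prob_uniform_Icc_le) auto
      then have "(exp 1 - 1) * prob {z \<in> space M. Q y z} \<le> 2 * p"
        using e1 by (intro mult_mono) auto
      then show "1 + (exp 1 - 1) * prob {z \<in> space M. Q y z} \<le> exp (2 * p)"
        using exp_ge_add_one_self[of "2 * p"] by linarith
    qed
    finally show ?thesis .
  qed
  have eq: "ennreal (exp (real (card {i \<in> B. u (\<omega> k) \<le> u (\<omega> i) \<and> u (\<omega> i) \<le> u (\<omega> k) + p}))) =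
      ennreal (exp 1) * (\<Prod>i\<in>A. \<phi> (\<omega> k) (\<omega> i))" for \<omega>
  proof -
    have "real (card {i \<in> B. u (\<omega> k) \<le> u (\<omega> i) \<and> u (\<omega> i) \<le> u (\<omega> k) + p}) = (\<Sum>i\<in>B. of_bool (Q (\<omega> k) (\<omega> i)))"
      using finB by (simp add: sum.If_cases of_bool_def Int_def Q_def)
    also have "\<dots> = 1 + (\<Sum>i\<in>A. of_bool (Q (\<omega> k) (\<omega> i)))"
      unfolding A_def using k finB p by (subst sum.remove[of _ k]) (auto simp: Q_def)
    finally show ?thesis using A
      by (simp add: exp_add exp_sum \<phi>_def prod_ennreal ennreal_mult prod_nonneg del: sum_of_bool_eq)
  qed
  have "(\<integral>\<^sup>+\<omega>. ennreal (exp (real (card {i \<in> B. u (\<omega> k) \<le> u (\<omega> i) \<and> u (\<omega> i) \<le> u (\<omega> k) + p})))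
      \<partial>(\<Pi>\<^sub>M i\<in>I. M)) = (\<integral>\<^sup>+\<omega>. ennreal (exp 1) * (\<Prod>i\<in>A. \<phi> (\<omega> k) (\<omega> i)) \<partial>(\<Pi>\<^sub>M i\<in>I. M))"
    unfolding eq ..
  also have "\<dots> = ennreal (exp 1) * (\<integral>\<^sup>+\<omega>. (\<Prod>i\<in>A. \<phi> (\<omega> k) (\<omega> i)) \<partial>(\<Pi>\<^sub>M i\<in>I. M))"
  proof (intro nn_integral_cmult borel_measurable_prod_ennreal)
    fix i assume "i \<in> A"
    then have "(\<lambda>\<omega>. (\<omega> k, \<omega> i)) \<in> measurable (\<Pi>\<^sub>M i\<in>I. M) (M \<Otimes>\<^sub>M M)"
      using A by (intro measurable_Pair measurable_component_singleton) auto
    then show "(\<lambda>\<omega>. \<phi> (\<omega> k) (\<omega> i)) \<in> borel_measurable (\<Pi>\<^sub>M i\<in>I. M)"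
      using measurable_compose[OF _ \<phi>, of "\<lambda>\<omega>. (\<omega> k, \<omega> i)"] by simp
  qed
  also have "\<dots> \<le> ennreal (exp 1) * ennreal (exp (2 * p)) ^ card A"
    using A fin le \<phi> by (intro mult_left_mono nn_integral_PiM_prod_pair_le) auto
  also have "\<dots> = ennreal (exp (1 + 2 * p * (real (card B) - 1)))"
    by (simp add: ennreal_power ennreal_mult[symmetric] exp_of_nat_mult[symmetric] exp_add[symmetric]
        A(4)[symmetric] mult_ac)
  finally show ?thesis .
qed

text \<open>Union bound over the left end of an empty interval of length \<open>x\<close>, which is
  0 or one of the points. Given the left end, every remaining point misses the interval with
  probability 1 - x \<le> exp (- x). Starting from a point leaves \<open>card V - 1\<close> others,
  hence the exponent.\<close>

lemma emeasure_large_gap_le: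
  fixes I V :: "nat set"
  assumes fin: "finite I" and V: "V \<subseteq> I" and j: "j \<in> I" "j \<notin> V" and x: "0 < x"
  shows "emeasure (\<Pi>\<^sub>M i\<in>I. M) {\<omega> \<in> space (\<Pi>\<^sub>M i\<in>I. M).
      \<exists>y\<in>insert 0 ((\<lambda>v. u (\<omega> v)) ` V). y + x < 1 \<and> \<not> (\<exists>v\<in>V. y < u (\<omega> v) \<and> u (\<omega> v) \<le> y + x)}
    \<le> ennreal ((real (card V) + 1) * exp (- x * (real (card V) - 1)))"
    (is "emeasure ?\<Omega> ?Bad \<le> _")
proof -
  define \<psi> where "\<psi> r z = (if r + x < 1 \<and> \<not> (r < u z \<and> u z \<le> r + x) then 1 else 0 :: ennreal)" for r z
  have finV: "finite V" using fin V by (rule finite_subset[rotated])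
  have int: "(\<integral>\<^sup>+z. \<psi> r z \<partial>M) \<le> ennreal (exp (- x))" if r: "0 \<le> r" for r
  proof (cases "r + x < 1")
    case True
    have "(\<integral>\<^sup>+z. \<psi> r z \<partial>M) = (\<integral>\<^sup>+z. indicator (space M - {z \<in> space M. r < u z \<and> u z \<le> r + x}) z \<partial>M)"
      using True by (intro nn_integral_cong) (auto simp: \<psi>_def indicator_def)
    also have "\<dots> = ennreal (1 - prob {z \<in> space M. r < u z \<and> u z \<le> r + x})"
      by (simp add: emeasure_eq_measure prob_compl)
    also have "prob {z \<in> space M. r < u z \<and> u z \<le> r + x} = x"
      using u unif r x True by (intro prob_uniform_Ioc) auto
    also have "ennreal (1 - x) \<le> ennreal (exp (- x))"
      using exp_ge_add_one_self[of "- x"] by (intro ennreal_leI) simp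
    finally show ?thesis .
  qed (simp add: \<psi>_def)
  have m1: "(\<lambda>(y, z). \<psi> (u y) z) \<in> borel_measurable (M \<Otimes>\<^sub>M M)" unfolding \<psi>_def by measurable
  have m0: "(\<lambda>(y, z). \<psi> 0 z) \<in> borel_measurable (M \<Otimes>\<^sub>M M)" unfolding \<psi>_def by measurable
  have m2: "(\<lambda>\<omega>. \<psi> (u (\<omega> v)) (\<omega> w)) \<in> borel_measurable ?\<Omega>" if "w \<in> V" "v \<in> V" for w v
    using measurable_compose[OF measurable_Pair[OF measurable_component_singleton[of v I "\<lambda>_. M"]
      measurable_component_singleton[of w I "\<lambda>_. M"]] m1] that V by auto
  have m3: "(\<lambda>\<omega>. \<psi> 0 (\<omega> w)) \<in> borel_measurable ?\<Omega>" if "w \<in> V" for w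
    using measurable_compose[OF measurable_Pair[OF measurable_component_singleton[of w I "\<lambda>_. M"]
      measurable_component_singleton[of w I "\<lambda>_. M"]] m0] that V by auto
  have Bad: "?Bad \<in> sets ?\<Omega>" using u finV V by (rule sets_large_gap)
  have "emeasure ?\<Omega> ?Bad = (\<integral>\<^sup>+\<omega>. indicator ?Bad \<omega> \<partial>?\<Omega>)"
    by (rule nn_integral_indicator[OF Bad, symmetric])
  also have "\<dots> \<le> (\<integral>\<^sup>+\<omega>. (\<Prod>w\<in>V. \<psi> 0 (\<omega> w)) + (\<Sum>v\<in>V. \<Prod>w\<in>V - {v}. \<psi> (u (\<omega> v)) (\<omega> w)) \<partial>?\<Omega>)"
  proof (rule nn_integral_mono)
    fix \<omega> assume "\<omega> \<in> space ?\<Omega>"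
    show "indicator ?Bad \<omega> \<le> (\<Prod>w\<in>V. \<psi> 0 (\<omega> w)) + (\<Sum>v\<in>V. \<Prod>w\<in>V - {v}. \<psi> (u (\<omega> v)) (\<omega> w))"
    proof (cases "\<omega> \<in> ?Bad")
      case True
      then consider "0 + x < 1" "\<not> (\<exists>v\<in>V. 0 < u (\<omega> v) \<and> u (\<omega> v) \<le> 0 + x)"
        | v where "v \<in> V" "u (\<omega> v) + x < 1" "\<not> (\<exists>w\<in>V. u (\<omega> v) < u (\<omega> w) \<and> u (\<omega> w) \<le> u (\<omega> v) + x)"
        by auto
      then show ?thesis
      proof cases
        case 1
        then have "(\<Prod>w\<in>V. \<psi> 0 (\<omega> w)) = 1" by (intro prod.neutral) (auto simp: \<psi>_def)
        then show ?thesis using True by simp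
      next
        case 2
        then have "(\<Prod>w\<in>V - {v}. \<psi> (u (\<omega> v)) (\<omega> w)) = 1" by (intro prod.neutral) (auto simp: \<psi>_def)
        moreover have "(\<Prod>w\<in>V - {v}. \<psi> (u (\<omega> v)) (\<omega> w)) \<le> (\<Sum>v\<in>V. \<Prod>w\<in>V - {v}. \<psi> (u (\<omega> v)) (\<omega> w))"
          using 2 finV by (intro member_le_sum) auto
        ultimately have "1 \<le> (\<Sum>v\<in>V. \<Prod>w\<in>V - {v}. \<psi> (u (\<omega> v)) (\<omega> w))" by simp
        then show ?thesis using True by (simp add: add_increasing)
      qed
    qed simp
  qed
  also have "\<dots> = (\<integral>\<^sup>+\<omega>. (\<Prod>w\<in>V. \<psi> 0 (\<omega> w)) \<partial>?\<Omega>) + (\<Sum>v\<in>V. \<integral>\<^sup>+\<omega>. (\<Prod>w\<in>V - {v}. \<psi> (u (\<omega> v)) (\<omega> w)) \<partial>?\<Omega>)"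
    using m3 m2 by (subst nn_integral_add)
      (auto intro!: borel_measurable_prod_ennreal borel_measurable_sum nn_integral_sum)
  also have "\<dots> \<le> ennreal (exp (- x * (real (card V) - 1))) + (\<Sum>v\<in>V. ennreal (exp (- x * (real (card V) - 1))))"
  proof (intro add_mono sum_mono)
    \<comment> \<open>From the left end 0 there is nothing to condition on; \<open>j\<close>, lying
      outside \<open>V\<close>, fills the slot of the conditioning coordinate. The exponent is then
      weakened to that of the other summands.\<close>
    have "(\<integral>\<^sup>+\<omega>. (\<Prod>w\<in>V. \<psi> 0 (\<omega> w)) \<partial>?\<Omega>) \<le> ennreal (exp (- x)) ^ card V"
      using nn_integral_PiM_prod_pair_le[OF fin j V m0 int] by simp
    also have "\<dots> = ennreal (exp (- x * real (card V)))"
      by (simp add: ennreal_power exp_of_nat_mult[symmetric] mult_ac)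
    also have "\<dots> \<le> ennreal (exp (- x * (real (card V) - 1)))"
      using x by (intro ennreal_leI) (simp add: algebra_simps)
    finally show "(\<integral>\<^sup>+\<omega>. (\<Prod>w\<in>V. \<psi> 0 (\<omega> w)) \<partial>?\<Omega>) \<le> \<dots>" .
    fix v assume v: "v \<in> V"
    have "(\<integral>\<^sup>+\<omega>. (\<Prod>w\<in>V - {v}. \<psi> (u (\<omega> v)) (\<omega> w)) \<partial>?\<Omega>) \<le> ennreal (exp (- x)) ^ card (V - {v})"
      using v V int u01 m1 by (intro nn_integral_PiM_prod_pair_le[OF fin]) auto
    also have "\<dots> = ennreal (exp (- x * real (card (V - {v}))))"
      by (simp add: ennreal_power exp_of_nat_mult[symmetric] mult_ac)
    also have "real (card (V - {v})) = real (card V) - 1"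
      using card_Suc_Diff1[OF finV v] by linarith
    finally show "(\<integral>\<^sup>+\<omega>. (\<Prod>w\<in>V - {v}. \<psi> (u (\<omega> v)) (\<omega> w)) \<partial>?\<Omega>) \<le> ennreal (exp (- x * (real (card V) - 1)))" .
  qed
  also have "\<dots> = ennreal ((real (card V) + 1) * exp (- x * (real (card V) - 1)))"
    by (simp add: ennreal_of_nat_eq_real_of_nat ennreal_mult'[symmetric] ennreal_plus[symmetric] distrib_right del: ennreal_plus)
  finally show ?thesis .
qed

end

text \<open>On the scale of \<open>F\<close> the scores are uniform. Off \<open>Bad\<close> the
  pointwise bound does not involve \<open>h\<close>, so the moment bound applies however
  \<open>h\<close> depends on the data; on \<open>Bad\<close> the trivial bound
  \<open>card B\<close> is paid.\<close>

lemma nn_integral_card_rank_window_le: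
  fixes I B V :: "nat set" and T :: "'a \<Rightarrow> real" and h :: "(nat \<Rightarrow> 'a) \<Rightarrow> nat"
  assumes T[measurable]: "T \<in> borel_measurable M" and cont: "\<And>t. prob {z \<in> space M. T z = t} = 0"
    and fin: "finite I" and B: "B \<subseteq> I" "B \<noteq> {}" and V: "V \<subseteq> I" and j: "j \<in> I" "j \<notin> V" and x: "0 < x"
  shows "(\<integral>\<^sup>+\<omega>. ennreal (real (card {i \<in> B. h \<omega> \<le> card {v \<in> V. T (\<omega> v) < T (\<omega> i)} + N \<and>
        card {v \<in> V. T (\<omega> v) < T (\<omega> i)} < h \<omega> + N})) \<partial>(\<Pi>\<^sub>M i\<in>I. M))
    \<le> ennreal (ln (real (card B)) + 2 + 4 * real N * x * real (card B)
        + real (card B) * ((real (card V) + 1) * exp (- x * (real (card V) - 1))))"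
    (is "(\<integral>\<^sup>+\<omega>. ennreal (real (card (?D \<omega>))) \<partial>?\<Omega>) \<le> _")
proof -
  define F where "F t = prob {z \<in> space M. T z \<le> t}" for t
  define u where "u z = F (T z)" for z
  define p where "p = real (2 * N) * x"
  define b where "b = real (card B)"
  \<comment> \<open>Chosen so that \<open>exp (- s)\<close> times the moment bound, summed over the
    \<open>b\<close> anchors, is exactly 1. That 1 and the one inside \<open>s\<close> make up the 2
    of the statement.\<close>
  define s where "s = ln b + 1 + 2 * p * (b - 1)"
  define Bad where "Bad = {\<omega> \<in> space ?\<Omega>. \<exists>y\<in>insert 0 ((\<lambda>v. u (\<omega> v)) ` V). y + x < 1 \<and>
    \<not> (\<exists>v\<in>V. y < u (\<omega> v) \<and> u (\<omega> v) \<le> y + x)}"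
  define Nb where "Nb \<omega> k = card {i \<in> B. u (\<omega> k) \<le> u (\<omega> i) \<and> u (\<omega> i) \<le> u (\<omega> k) + p}" for \<omega> k
  have finB: "finite B" and finV: "finite V" using fin B V by (auto intro: finite_subset)
  have b1: "1 \<le> b" using B(2) finB by (simp add: b_def Suc_le_eq card_gt_0_iff)
  have p: "0 \<le> p" using x by (simp add: p_def)
  have s: "0 \<le> s" using b1 p by (simp add: s_def)
  have mono: "mono F" unfolding F_def by (intro monoI finite_measure_mono) auto
  have [measurable]: "F \<in> borel_measurable borel" by (rule borel_measurable_mono[OF mono])
  have F01: "0 \<le> F t" "F t \<le> 1" for t by (simp_all add: F_def)
  have u[measurable]: "u \<in> borel_measurable M" unfolding u_def by measurable
  have unif: "prob {z \<in> space M. u z \<le> y} = y" if "0 \<le> y" "y \<le> 1" for y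
    unfolding u_def F_def using T cont that by (rule prob_cdf_transform_le)
  have um: "(\<lambda>\<omega>. u (\<omega> v)) \<in> borel_measurable ?\<Omega>" if "v \<in> I" for v
    using that by (intro measurable_compose[OF measurable_component_singleton[of v I "\<lambda>_. M"] u])
  have Bad: "Bad \<in> sets ?\<Omega>"
    unfolding Bad_def using u finV V by (rule sets_large_gap)
  have Nb[measurable]: "(\<lambda>\<omega>. Nb \<omega> k) \<in> measurable ?\<Omega> (count_space UNIV)" if k: "k \<in> B" for k
    unfolding Nb_def
  proof (rule measurable_card)
    fix i
    have kI: "k \<in> I" using k B by auto
    show "{\<omega> \<in> space ?\<Omega>. i \<in> {i \<in> B. u (\<omega> k) \<le> u (\<omega> i) \<and> u (\<omega> i) \<le> u (\<omega> k) + p}} \<in> sets ?\<Omega>"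
    proof (cases "i \<in> B")
      case True
      then have "i \<in> I" using B by auto
      then show ?thesis using kI True um
        by (simp) (intro sets.sets_Collect_conj borel_measurable_le borel_measurable_add borel_measurable_const um)
    qed simp
  qed
  have pt: "ennreal (real (card (?D \<omega>))) \<le> ennreal s + (\<Sum>k\<in>B. ennreal (exp (- s)) * ennreal (exp (real (Nb \<omega> k))))
      + ennreal b * indicator Bad \<omega>" if \<omega>: "\<omega> \<in> space ?\<Omega>" for \<omega>
  proof (cases "\<omega> \<in> Bad")
    case True
    have "card (?D \<omega>) \<le> card B" using finB by (intro card_mono) auto
    then have "ennreal (real (card (?D \<omega>))) \<le> ennreal b" by (intro ennreal_leI) (simp add: b_def)
    then show ?thesis using True by (simp add: add_increasing)
  next
    case False
    have "real (card (?D \<omega>)) \<le> s + (\<Sum>k\<in>B. exp (real (Nb \<omega> k) - s))"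
      using False \<omega> unfolding Nb_def p_def u_def Bad_def
      by (intro card_rank_window_le[where T = "\<lambda>i. T (\<omega> i)", OF finV finB mono F01 _ _ s]) (use x in auto)
    then have "ennreal (real (card (?D \<omega>))) \<le> ennreal (s + (\<Sum>k\<in>B. exp (- s) * exp (real (Nb \<omega> k))))"
      by (intro ennreal_leI) (simp add: exp_add[symmetric])
    also have "\<dots> = ennreal s + (\<Sum>k\<in>B. ennreal (exp (- s)) * ennreal (exp (real (Nb \<omega> k))))"
      using s by (simp add: ennreal_plus sum_nonneg sum_ennreal[symmetric] ennreal_mult)
    finally show ?thesis using False by simp
  qed
  interpret \<Omega>: prob_space ?\<Omega> by (intro prob_space_PiM) unfold_locales
  have "(\<integral>\<^sup>+\<omega>. ennreal (real (card (?D \<omega>))) \<partial>?\<Omega>) \<le>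
     (\<integral>\<^sup>+\<omega>. ennreal s + (\<Sum>k\<in>B. ennreal (exp (- s)) * ennreal (exp (real (Nb \<omega> k)))) + ennreal b * indicator Bad \<omega> \<partial>?\<Omega>)"
    by (intro nn_integral_mono pt)
  also have "\<dots> = ennreal s + (\<Sum>k\<in>B. ennreal (exp (- s)) * (\<integral>\<^sup>+\<omega>. ennreal (exp (real (Nb \<omega> k))) \<partial>?\<Omega>)) + ennreal b * emeasure ?\<Omega> Bad"
    using Bad Nb
    by (simp add: nn_integral_add nn_integral_sum nn_integral_cmult nn_integral_cmult_indicator \<Omega>.emeasure_space_1)
  also have "\<dots> \<le> ennreal s + (\<Sum>k\<in>B. ennreal (exp (- s)) * ennreal (exp (1 + 2 * p * (b - 1)))) +
      ennreal b * ennreal ((real (card V) + 1) * exp (- x * (real (card V) - 1)))"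
    unfolding Nb_def b_def Bad_def
    by (intro add_mono order_refl sum_mono mult_left_mono nn_integral_exp_card_neighbours_le emeasure_large_gap_le)
      (use u unif F01 fin B V j x p in \<open>auto simp: u_def\<close>)
  also have "(\<Sum>k\<in>B. ennreal (exp (- s)) * ennreal (exp (1 + 2 * p * (b - 1)))) = 1"
  proof -
    have "b * (exp (- s) * exp (1 + 2 * p * (b - 1))) = b * exp (- ln b)"
      by (simp add: exp_add[symmetric] s_def)
    also have "\<dots> = 1" using b1 by (simp add: exp_minus)
    finally show ?thesis by (simp add: b_def ennreal_of_nat_eq_real_of_nat ennreal_mult'[symmetric])
  qed
  also have "ennreal s + 1 + ennreal b * ennreal ((real (card V) + 1) * exp (- x * (real (card V) - 1))) =
      ennreal (s + 1 + b * ((real (card V) + 1) * exp (- x * (real (card V) - 1))))"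
    using s b1 by (simp add: ennreal_plus ennreal_mult)
  also have "\<dots> \<le> ennreal (ln b + 2 + 4 * real N * x * b
        + b * ((real (card V) + 1) * exp (- x * (real (card V) - 1))))"
  proof -
    have "2 * p * (b - 1) \<le> 4 * real N * x * b" using x by (simp add: p_def algebra_simps)
    then show ?thesis by (intro ennreal_leI) (simp add: s_def)
  qed
  finally show ?thesis unfolding b_def .
qed

end

section \<open>Measurability and relabelling\<close>

text \<open>Given one coordinate, another one hits the same value with probability 0 by continuity;
  this is the conditioning bound with \<open>c = 0\<close>, applied to finitely many pairs.\<close>

lemma (in prob_space) AE_PiM_inj_on:
  fixes f :: "'a \<Rightarrow> real"
  assumes f[measurable]: "f \<in> borel_measurable M" and cont: "\<And>t. prob {z \<in> space M. f z = t} = 0"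
    and fin: "finite I"
  shows "AE \<omega> in (\<Pi>\<^sub>M i\<in>I. M). inj_on (\<lambda>i. f (\<omega> i)) I"
proof -
  define \<phi> :: "'a \<Rightarrow> 'a \<Rightarrow> ennreal" where "\<phi> y z = indicator {z. f y = f z} z" for y z
  have \<phi>: "(\<lambda>(y, z). \<phi> y z) \<in> borel_measurable (M \<Otimes>\<^sub>M M)"
    unfolding \<phi>_def indicator_def mem_Collect_eq by measurable
  have "AE \<omega> in (\<Pi>\<^sub>M i\<in>I. M). f (\<omega> i) \<noteq> f (\<omega> k)" if ik: "i \<in> I" "k \<in> I" "i \<noteq> k" for i k
  proof -
    have "(\<integral>\<^sup>+z. \<phi> y z \<partial>M) \<le> 0" if "y \<in> space M" for y
    proof -
      have "(\<integral>\<^sup>+z. \<phi> y z \<partial>M) = (\<integral>\<^sup>+z. indicator {z \<in> space M. f z = f y} z \<partial>M)"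
        by (intro nn_integral_cong) (auto simp: \<phi>_def indicator_def)
      then show ?thesis using cont[of "f y"] by (simp add: emeasure_eq_measure)
    qed
    then have "(\<integral>\<^sup>+\<omega>. (\<Prod>i\<in>{k}. \<phi> (\<omega> i') (\<omega> i)) \<partial>(\<Pi>\<^sub>M i\<in>I. M)) \<le> 0 ^ card {k}" if "i' = i" for i'
      using ik fin \<phi> that by (intro nn_integral_PiM_prod_pair_le) auto
    then have "(\<integral>\<^sup>+\<omega>. \<phi> (\<omega> i) (\<omega> k) \<partial>(\<Pi>\<^sub>M i\<in>I. M)) = 0" by simp
    moreover have "(\<lambda>\<omega>. \<phi> (\<omega> i) (\<omega> k)) \<in> borel_measurable (\<Pi>\<^sub>M i\<in>I. M)"
      using measurable_compose[OF measurable_Pair[OF measurable_component_singleton[of i I "\<lambda>_. M"]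
        measurable_component_singleton[of k I "\<lambda>_. M"]] \<phi>] ik by auto
    ultimately have "AE \<omega> in (\<Pi>\<^sub>M i\<in>I. M). \<phi> (\<omega> i) (\<omega> k) = 0" by (simp add: nn_integral_0_iff_AE)
    then show ?thesis by (rule AE_mp) (auto simp: \<phi>_def indicator_def intro!: AE_I2 split: if_splits)
  qed
  then have "AE \<omega> in (\<Pi>\<^sub>M i\<in>I. M). i \<noteq> k \<longrightarrow> f (\<omega> i) \<noteq> f (\<omega> k)" if "i \<in> I" "k \<in> I" for i k
    using that by (cases "i = k") auto
  then have "AE \<omega> in (\<Pi>\<^sub>M i\<in>I. M). \<forall>i\<in>I. \<forall>k\<in>I. i \<noteq> k \<longrightarrow> f (\<omega> i) \<noteq> f (\<omega> k)"
    by (intro AE_ball_countable' countable_finite fin)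
  then show ?thesis by (rule AE_mp) (intro AE_I2 impI, auto simp: inj_on_def)
qed

text \<open>Every ingredient is the size of a subset of \<open>B\<close> described through
  \<open>l\<close> and \<open>R\<close>, and a permutation of \<open>B\<close> preserves such
  sizes.\<close>

lemma excess_relabel:
  assumes bij: "bij_betw \<sigma> B B" and j: "j \<in> B"
    and l: "\<And>i. i \<in> B \<Longrightarrow> l' i = l (\<sigma> i)" and R: "\<And>i. i \<in> B \<Longrightarrow> R' i = R (\<sigma> i)"
  shows "excess \<alpha> l' R' B h j = excess \<alpha> l R B h (\<sigma> j)"
proof -
  have inj: "inj_on \<sigma> A" if "A \<subseteq> B" for A
    using bij that by (auto simp: bij_betw_def intro: inj_on_subset)
  have im: "\<sigma> ` {i \<in> B. Q (\<sigma> i)} = {i \<in> B. Q i}" for Q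
    using bij by (auto simp: bij_betw_def)
  have card_eq: "card {i \<in> B. Q (\<sigma> i)} = card {i \<in> B. Q i}" for Q
    using card_image[OF inj, of "{i \<in> B. Q (\<sigma> i)}"] im[of Q] by simp
  have "below l' B h = {i \<in> B. l (\<sigma> i) < h}" using l by (auto simp: below_def)
  then have c1: "card (below l' B h) = card (below l B h)"
    using card_eq[of "\<lambda>i. l i < h"] by (simp add: below_def)
  have "{i \<in> below l' B h. R' i < R' j} = {i \<in> B. l (\<sigma> i) < h \<and> R (\<sigma> i) < R (\<sigma> j)}"
    using l R j by (auto simp: below_def)
  then have "card {i \<in> below l' B h. R' i < R' j} = card {i \<in> below l B h. R i < R (\<sigma> j)}"
    using card_eq[of "\<lambda>i. l i < h \<and> R i < R (\<sigma> j)"] by (simp add: below_def conj_assoc)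
  then show ?thesis using c1 l[OF j] by (simp add: excess_def exceeds_def)
qed

lemma measurable_card_filter:
  assumes "\<And>i. i \<in> A \<Longrightarrow> {\<omega> \<in> space N. Q \<omega> i} \<in> sets N"
  shows "(\<lambda>\<omega>. card {i \<in> A. Q \<omega> (i::nat)}) \<in> measurable N (count_space UNIV)"
proof (rule measurable_card)
  fix i show "{\<omega> \<in> space N. i \<in> {i \<in> A. Q \<omega> i}} \<in> sets N"
    using assms[of i] by (cases "i \<in> A") auto
qed

text \<open>Past the end the value depends on the overshoot alone and not on the list; hence an
  order statistic of too large an index is constant.\<close>

lemma nth_length_add: "xs ! (length xs + n) = [] ! n"
  by (induction xs) auto

lemma borel_measurable_kth_smallest:
  fixes f :: "'a \<Rightarrow> nat \<Rightarrow> real"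
  assumes fin: "finite A" and f: "\<And>i. i \<in> A \<Longrightarrow> (\<lambda>\<omega>. f \<omega> i) \<in> borel_measurable N"
  shows "(\<lambda>\<omega>. kth_smallest A (f \<omega>) r) \<in> borel_measurable N"
proof -
  have main: "(\<lambda>\<omega>. kth_smallest A (f \<omega>) r) \<in> borel_measurable N" if r: "1 \<le> r" "r \<le> card A" for r
    unfolding borel_measurable_iff_ge le_kth_smallest_iff[OF fin r]
  proof
    fix a
    have "(\<lambda>\<omega>. card {i \<in> A. f \<omega> i < a}) \<in> measurable N (count_space UNIV)"
      using f by (intro measurable_card_filter borel_measurable_less) auto
    then have "(\<lambda>\<omega>. card {i \<in> A. f \<omega> i < a}) -` {..<r} \<inter> space N \<in> sets N"
      by (rule measurable_sets) simp
    also have "(\<lambda>\<omega>. card {i \<in> A. f \<omega> i < a}) -` {..<r} \<inter> space N =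
      {\<omega> \<in> space N. card {i \<in> A. f \<omega> i < a} < r}" by auto
    finally show "{\<omega> \<in> space N. card {i \<in> A. f \<omega> i < a} < r} \<in> sets N" .
  qed
  show ?thesis
  proof (cases "r - 1 < card A")
    case True
    \<comment> \<open>Truncated subtraction makes \<open>r = 0\<close> and \<open>r = 1\<close> read
      the same entry; writing \<open>r - 1 + 1\<close> brings both into the range of
      \<open>main\<close>.\<close>
    then have "kth_smallest A f r = kth_smallest A f (r - 1 + 1)" for f by (simp add: kth_smallest_def)
    then show ?thesis using main[of "r - 1 + 1"] True by simp
  next
    case False
    then obtain n where n: "r - 1 = card A + n" using le_Suc_ex[of "card A" "r - 1"] by auto
    have "kth_smallest A (f \<omega>) r = [] ! n" for \<omega>
      using nth_length_add[of "sort (map (f \<omega>) (sorted_list_of_set A))" n]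
      by (simp add: kth_smallest_def n[simplified])
    then show ?thesis by simp
  qed
qed

text \<open>Ceilings, quotients and case distinctions of natural-valued statistics need no separate
  treatment, since every function on a countable discrete domain is measurable.\<close>

lemma measurable_countable_compose4:
  fixes \<phi> :: "nat \<Rightarrow> nat \<Rightarrow> nat \<Rightarrow> nat \<Rightarrow> 'b"
  assumes "a \<in> measurable N (count_space UNIV)" "b \<in> measurable N (count_space UNIV)"
    "c \<in> measurable N (count_space UNIV)" "e \<in> measurable N (count_space UNIV)"
    "\<And>w x y z. \<phi> w x y z \<in> space L"
  shows "(\<lambda>\<omega>. \<phi> (a \<omega>) (b \<omega>) (c \<omega>) (e \<omega>)) \<in> measurable N L"
  by (rule measurable_compose_countable[where g=a, OF measurable_compose_countable[where g=b,
        OF measurable_compose_countable[where g=c, OF measurable_compose_countable[where g=e,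
        OF measurable_const]]]]) (use assms in auto)

lemma sets_Collect_nat_pair:
  fixes a b :: "'b \<Rightarrow> nat"
  assumes "a \<in> measurable N (count_space UNIV)" "b \<in> measurable N (count_space UNIV)"
  shows "{\<omega> \<in> space N. Q (a \<omega>) (b \<omega>)} \<in> sets N"
proof -
  have "(\<lambda>\<omega>. Q (a \<omega>) (b \<omega>)) \<in> measurable N (count_space UNIV)"
    using measurable_countable_compose4[OF assms assms, of "\<lambda>w x y z. Q w x"] by simp
  then show ?thesis by (simp add: pred_def)
qed

text \<open>Allows additive constants to be absorbed into logarithms.\<close>

lemma half_le_ln: "1 / 2 \<le> ln (real n)" if "2 \<le> n"
proof -
  have "exp (1 / 2) \<le> real n" using exp_half_le2 that by linarith
  then show ?thesis using that by (subst ln_ge_iff) auto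
qed

section \<open>Calibration-assisted selection\<close>

locale calibrated_selection = prob_space P for P :: "point measure" +
  fixes d :: nat and C U :: "nat set" and mu g :: "(nat \<Rightarrow> real) \<Rightarrow> real"
    and \<kappa> :: "(nat \<Rightarrow> real) \<Rightarrow> nat" and \<alpha> \<gamma> t_u t_c :: real and I_u I_c :: nat
  assumes fin: "finite C" "finite U" and disj: "C \<inter> U = {}"
    and sets_P: "sets P = sets (point_space d)"
    and mu: "mu \<in> borel_measurable (feature_space d)"
    and g: "g \<in> borel_measurable (feature_space d)"
    and \<kappa>: "\<kappa> \<in> measurable (\<Pi>\<^sub>M i\<in>C \<union> U. (borel :: real measure)) (count_space UNIV)"
    and \<kappa>_range: "\<And>v. v \<in> space (\<Pi>\<^sub>M i\<in>C \<union> U. (borel :: real measure)) \<Longrightarrow> \<kappa> v \<in> {1..card U}"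
    and \<alpha>: "0 < \<alpha>" "\<alpha> < 1"
    and cont_T: "\<And>t. prob {z \<in> space P. g (fst z) = t} = 0"
    and cont_R: "\<And>r. prob {z \<in> space P. \<bar>snd z - mu (fst z)\<bar> = r} = 0"
    and \<gamma>: "0 < \<gamma>"
    and stable: "AE \<omega> in (\<Pi>\<^sub>M i\<in>C \<union> U. P).
       (\<forall>j \<in> sel_u \<kappa> g C U \<omega>. khat_rep1 \<kappa> g C U \<omega> j t_u = khat \<kappa> g C U \<omega>) \<and>
       (\<forall>j \<in> U - sel_u \<kappa> g C U \<omega>. khat \<kappa> g C U \<omega> \<le> khat_rep1 \<kappa> g C U \<omega> j t_u \<and>
            khat_rep1 \<kappa> g C U \<omega> j t_u \<le> khat \<kappa> g C U \<omega> + I_u) \<and>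
       (\<forall>j \<in> U. \<forall>k \<in> C. khat_rep1 \<kappa> g C U \<omega> j t_u \<le> khat_rep2 \<kappa> g C U \<omega> j t_u k t_c \<and>
            khat_rep2 \<kappa> g C U \<omega> j t_u k t_c \<le> khat_rep1 \<kappa> g C U \<omega> j t_u + I_c) \<and>
       \<lceil>\<gamma> * real (card U)\<rceil> \<le> int (khat \<kappa> g C U \<omega>) \<and>
       int (khat \<kappa> g C U \<omega>) \<le> int (card U) - 1"
begin

abbreviation "\<Omega> \<equiv> (\<Pi>\<^sub>M i\<in>C \<union> U. P)"
abbreviation "T \<equiv> score g"
abbreviation "R \<equiv> resid mu"
abbreviation "kh \<equiv> khat \<kappa> g C U"
abbreviation "S \<equiv> sel_u \<kappa> g C U"

text \<open>For a test index \<open>j\<close>: \<open>h j\<close> is the threshold with \<open>T\<^sub>j\<close> erased, \<open>l j i\<close> the rank of \<open>T\<^sub>i\<close> among the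
  other test scores, and \<open>W j\<close> the contribution of \<open>j\<close> to the false coverage proportion minus \<open>\<alpha>\<close>
  if selection were decided by \<open>l j j < h j\<close>.\<close>

definition h :: "nat \<Rightarrow> sample \<Rightarrow> nat" where
  "h j \<omega> = khat_rep1 \<kappa> g C U \<omega> j t_u"

definition l :: "nat \<Rightarrow> sample \<Rightarrow> nat \<Rightarrow> nat" where
  "l j \<omega> i = card {v \<in> U - {j}. T \<omega> v < T \<omega> i}"

definition W :: "nat \<Rightarrow> sample \<Rightarrow> real" where
  "W j \<omega> = excess \<alpha> (l j \<omega>) (R \<omega>) (insert j C) (h j \<omega>) j"

text \<open>The restriction keeps the exchanged sample in the space of the product measure, whose
  elements are undefined outside the index set; on that space \<open>swap j j\<close> is the
  identity.\<close>

definition swap :: "nat \<Rightarrow> nat \<Rightarrow> sample \<Rightarrow> sample" where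
  "swap j k \<omega> = (\<lambda>i\<in>C \<union> U. \<omega> (Transposition.transpose j k i))"

sublocale \<Omega>: prob_space \<Omega> by (intro prob_space_PiM) unfold_locales

section \<open>Measurability of scores, thresholds and the false coverage proportion\<close>

lemma measurable_g: "(\<lambda>z. g (fst z)) \<in> borel_measurable P"
  unfolding measurable_cong_sets[OF sets_P refl] point_space_def
  using g by measurable

lemma measurable_r: "(\<lambda>z. \<bar>snd z - mu (fst z)\<bar>) \<in> borel_measurable P"
  unfolding measurable_cong_sets[OF sets_P refl] point_space_def
  using mu by measurable

lemma measurable_T: "i \<in> C \<union> U \<Longrightarrow> (\<lambda>\<omega>. T \<omega> i) \<in> borel_measurable \<Omega>"
  unfolding score_def
  using measurable_compose[OF measurable_component_singleton[of i "C \<union> U" "\<lambda>_. P"] measurable_g] by simp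

lemma measurable_R: "i \<in> C \<union> U \<Longrightarrow> (\<lambda>\<omega>. R \<omega> i) \<in> borel_measurable \<Omega>"
  unfolding resid_def
  using measurable_compose[OF measurable_component_singleton[of i "C \<union> U" "\<lambda>_. P"] measurable_r] by simp

lemma measurable_h: "(\<lambda>\<omega>. h j \<omega>) \<in> measurable \<Omega> (count_space UNIV)" if "j \<in> U"
proof -
  have "(score_vec g (C \<union> U) \<omega>)(j := t_u) = (\<lambda>i\<in>C \<union> U. if i = j then t_u else T \<omega> i)" for \<omega>
    using that by (auto simp: score_vec_def fun_eq_iff)
  moreover have "(\<lambda>\<omega>. \<lambda>i\<in>C \<union> U. if i = j then t_u else T \<omega> i) \<in> measurable \<Omega> (\<Pi>\<^sub>M i\<in>C \<union> U. borel)"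
    using measurable_T by (intro measurable_restrict) auto
  ultimately show ?thesis
    unfolding h_def khat_rep1_def using measurable_compose[OF _ \<kappa>] by simp
qed

lemma measurable_score_vec: "score_vec g (C \<union> U) \<in> measurable \<Omega> (\<Pi>\<^sub>M i\<in>C \<union> U. borel)"
proof -
  have "(\<lambda>\<omega>. \<lambda>i\<in>C \<union> U. T \<omega> i) \<in> measurable \<Omega> (\<Pi>\<^sub>M i\<in>C \<union> U. borel)"
    using measurable_T by (intro measurable_restrict) auto
  then show ?thesis by (simp add: score_vec_def[abs_def])
qed

lemma measurable_kh: "kh \<in> measurable \<Omega> (count_space UNIV)"
  unfolding khat_def[abs_def] by (rule measurable_compose[OF measurable_score_vec \<kappa>])

lemma measurable_l: "i \<in> C \<union> U \<Longrightarrow> (\<lambda>\<omega>. l j \<omega> i) \<in> measurable \<Omega> (count_space UNIV)"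
  unfolding l_def by (intro measurable_card_filter borel_measurable_less measurable_T) auto

lemma measurable_W: "W j \<in> borel_measurable \<Omega>" if j: "j \<in> U"
proof -
  let ?B = "\<lambda>\<omega>. below (l j \<omega>) (insert j C) (h j \<omega>)"
  have sub: "i \<in> C \<union> U" if "i \<in> insert j C" for i using that j by auto
  have m1: "(\<lambda>\<omega>. card (?B \<omega>)) \<in> measurable \<Omega> (count_space UNIV)"
    unfolding below_def using sub measurable_l measurable_h[OF j]
    by (intro measurable_card_filter sets_Collect_nat_pair[where Q="(<)"]) auto
  have m2: "(\<lambda>\<omega>. card {i \<in> ?B \<omega>. R \<omega> i < R \<omega> j}) \<in> measurable \<Omega> (count_space UNIV)"
    unfolding below_def mem_Collect_eq conj_assoc using sub measurable_l measurable_h[OF j] j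
    by (intro measurable_card_filter sets.sets_Collect_conj sets_Collect_nat_pair[where Q="(<)"]
        borel_measurable_less measurable_R) auto
  \<comment> \<open>\<open>W j\<close> is a function of four natural-valued statistics, so
    measurability reduces to theirs.\<close>
  define \<phi> where "\<phi> a b c e = (if c < e then (of_bool (\<lceil>(1 - \<alpha>) * real a\<rceil> \<le> int b) - \<alpha>) / real e else 0)"
    for a b c e :: nat
  have "W j = (\<lambda>\<omega>. \<phi> (card (?B \<omega>)) (card {i \<in> ?B \<omega>. R \<omega> i < R \<omega> j}) (l j \<omega> j) (h j \<omega>))"
    by (rule ext) (simp only: W_def excess_def exceeds_def \<phi>_def)
  then show ?thesis
    using measurable_countable_compose4[OF m1 m2 measurable_l[OF sub[of j]] measurable_h[OF j], of \<phi> borel] by simp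
qed

text \<open>On the null event that the threshold equals \<^term>\<open>card U\<close>, \<^const>\<open>sel_c_plus\<close> reads past
  the end of the sorted list; the value found there is a constant, so measurability survives.\<close>

lemma measurable_fcp: "fcp \<alpha> mu g \<kappa> C U \<in> borel_measurable \<Omega>"
proof -
  have kth: "(\<lambda>\<omega>. kth_smallest U (T \<omega>) (kh \<omega> + c)) \<in> borel_measurable \<Omega>" for c
    by (rule measurable_compose_countable[where g=kh, OF borel_measurable_kth_smallest[OF fin(2)] measurable_kh])
      (simp add: measurable_T)
  have Sc: "{\<omega> \<in> space \<Omega>. T \<omega> i \<le> kth_smallest U (T \<omega>) (kh \<omega> + 1)} \<in> sets \<Omega>" if "i \<in> C" for i
    using that by (intro borel_measurable_le measurable_T kth) auto
  have Su: "{\<omega> \<in> space \<Omega>. T \<omega> i \<le> kth_smallest U (T \<omega>) (kh \<omega>)} \<in> sets \<Omega>" if "i \<in> U" for i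
    using that kth[of 0] by (intro borel_measurable_le measurable_T) auto
  have m1: "(\<lambda>\<omega>. card (sel_c_plus \<kappa> g C U \<omega>)) \<in> measurable \<Omega> (count_space UNIV)"
    unfolding sel_c_plus_def by (intro measurable_card_filter Sc)
  have m2: "(\<lambda>\<omega>. card {i \<in> sel_c_plus \<kappa> g C U \<omega>. R \<omega> i < R \<omega> j}) \<in> measurable \<Omega> (count_space UNIV)"
    if "j \<in> U" for j
    unfolding sel_c_plus_def mem_Collect_eq conj_assoc using that
    by (intro measurable_card_filter sets.sets_Collect_conj Sc borel_measurable_less measurable_R) auto
  have finc: "finite (sel_c_plus \<kappa> g C U \<omega>)" for \<omega> using fin by (simp add: sel_c_plus_def)
  have m3: "(\<lambda>\<omega>. card (S \<omega>)) \<in> measurable \<Omega> (count_space UNIV)"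
    unfolding sel_u_def by (intro measurable_card_filter Su)
  have m4: "(\<lambda>\<omega>. card {j \<in> S \<omega>. conf_quantile \<alpha> (sel_c_plus \<kappa> g C U \<omega>) (R \<omega>) < ereal (R \<omega> j)})
      \<in> measurable \<Omega> (count_space UNIV)"
    unfolding conf_quantile_less_iff[OF finc \<alpha>]
    unfolding sel_u_def mem_Collect_eq conj_assoc
    by (intro measurable_card_filter sets.sets_Collect_conj Su m1 m2
        sets_Collect_nat_pair[where Q="\<lambda>a b. \<lceil>(1 - \<alpha>) * (real a + 1)\<rceil> \<le> int b"])
  show ?thesis
    unfolding fcp_def[abs_def] Let_def
    using measurable_countable_compose4[OF m4 m3 m3 m3, of "\<lambda>a b c e. real a / real (max b 1)" borel] by simp
qed

section \<open>From the false coverage proportion to the sum of the \<open>W j\<close>\<close>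

lemma kh_range: "\<omega> \<in> space \<Omega> \<Longrightarrow> 1 \<le> kh \<omega> \<and> kh \<omega> \<le> card U"
  using \<kappa>_range[OF measurable_space[OF measurable_score_vec]] by (auto simp: khat_def)

lemma mem_S_iff: "\<omega> \<in> space \<Omega> \<Longrightarrow> j \<in> S \<omega> \<longleftrightarrow> j \<in> U \<and> card {v \<in> U. T \<omega> v < T \<omega> j} < kh \<omega>"
  using le_kth_smallest_iff[OF fin(2), of "kh \<omega>" "T \<omega> j" "T \<omega>"] kh_range by (auto simp: sel_u_def)

lemma l_self: "l j \<omega> j = card {v \<in> U. T \<omega> v < T \<omega> j}"
  unfolding l_def by (rule arg_cong[where f=card]) auto

text \<open>This is where the rank \<open>kh + 1\<close> in the calibration set matters. If
  \<open>T j < T i\<close>, deleting \<open>j\<close> lowers the rank of \<open>T i\<close> by one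
  and turns the cut-off \<open>kh + 1\<close> into \<open>kh\<close>. Otherwise \<open>T i\<close>
  ranks no higher than the selected \<open>T j\<close> and passes both tests. So the calibration set
  together with \<open>j\<close> is exactly the set cut out by \<open>l j\<close>.\<close>

lemma W_eq_of_selected:
  assumes \<omega>: "\<omega> \<in> space \<Omega>" and j: "j \<in> S \<omega>" and hj: "h j \<omega> = kh \<omega>" and km: "kh \<omega> < card U"
  shows "W j \<omega> = (of_bool (conf_quantile \<alpha> (sel_c_plus \<kappa> g C U \<omega>) (R \<omega>) < ereal (R \<omega> j)) - \<alpha>) / real (kh \<omega>)"
proof -
  let ?Sc = "sel_c_plus \<kappa> g C U \<omega>"
  have jU: "j \<in> U" and rj: "card {v \<in> U. T \<omega> v < T \<omega> j} < kh \<omega>" using mem_S_iff[OF \<omega>] j by auto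
  have jC: "j \<notin> C" using jU disj by auto
  have finc: "finite ?Sc" using fin by (simp add: sel_c_plus_def)
  have iff: "T \<omega> i \<le> kth_smallest U (T \<omega>) (kh \<omega> + 1) \<longleftrightarrow> l j \<omega> i < kh \<omega>" for i
  proof -
    have "T \<omega> i \<le> kth_smallest U (T \<omega>) (kh \<omega> + 1) \<longleftrightarrow> card {v \<in> U. T \<omega> v < T \<omega> i} < kh \<omega> + 1"
      using km by (intro le_kth_smallest_iff[OF fin(2)]) auto
    also have "\<dots> \<longleftrightarrow> l j \<omega> i < kh \<omega>"
    proof (cases "T \<omega> j < T \<omega> i")
      case True
      then have "{v \<in> U. T \<omega> v < T \<omega> i} = insert j {v \<in> U - {j}. T \<omega> v < T \<omega> i}" using jU by auto
      then have "card {v \<in> U. T \<omega> v < T \<omega> i} = Suc (l j \<omega> i)" using fin by (simp add: l_def)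
      then show ?thesis by simp
    next
      case False
      have "card {v \<in> U. T \<omega> v < T \<omega> i} \<le> card {v \<in> U. T \<omega> v < T \<omega> j}"
        using False fin by (intro card_mono) auto
      moreover have "l j \<omega> i \<le> card {v \<in> U. T \<omega> v < T \<omega> i}"
        unfolding l_def using fin by (intro card_mono) auto
      ultimately show ?thesis using rj by auto
    qed
    finally show ?thesis .
  qed
  have lj: "l j \<omega> j < kh \<omega>" using rj by (simp add: l_self)
  have below: "below (l j \<omega>) (insert j C) (kh \<omega>) = insert j ?Sc"
    using lj iff by (auto simp: below_def sel_c_plus_def)
  have "j \<notin> ?Sc" using jC by (simp add: sel_c_plus_def)
  then have c: "card (insert j ?Sc) = card ?Sc + 1" using finc by simp
  have "{i \<in> insert j ?Sc. R \<omega> i < R \<omega> j} = {i \<in> ?Sc. R \<omega> i < R \<omega> j}" by auto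
  then have "exceeds \<alpha> (R \<omega>) (insert j ?Sc) j \<longleftrightarrow> conf_quantile \<alpha> ?Sc (R \<omega>) < ereal (R \<omega> j)"
    unfolding exceeds_def conf_quantile_less_iff[OF finc \<alpha>] c by (simp add: add.commute)
  then show ?thesis using lj by (simp add: W_def excess_def hj below)
qed

text \<open>Distinct scores make the number of selections equal to \<open>kh\<close>, so the
  selected terms add up to the proportion minus \<alpha>. An unselected \<open>j\<close> contributes
  only if its rank lies between \<open>kh\<close> and \<open>kh + I_u\<close>; there are at most
  \<open>I_u\<close> such ranks, each costing at most \<open>1 / M\<close>.\<close>

lemma fcp_minus_sum_W_le:
  assumes \<omega>: "\<omega> \<in> space \<Omega>" and inj: "inj_on (T \<omega>) U" and km: "kh \<omega> < card U"
    and hS: "\<And>j. j \<in> S \<omega> \<Longrightarrow> h j \<omega> = kh \<omega>"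
    and hU: "\<And>j. j \<in> U - S \<omega> \<Longrightarrow> kh \<omega> \<le> h j \<omega> \<and> h j \<omega> \<le> kh \<omega> + I_u"
    and M: "0 < M" "M \<le> real (kh \<omega>)"
  shows "\<bar>fcp \<alpha> mu g \<kappa> C U \<omega> - \<alpha> - (\<Sum>j\<in>U. W j \<omega>)\<bar> \<le> real I_u / M"
proof -
  let ?r = "\<lambda>j. card {v \<in> U. T \<omega> v < T \<omega> j}"
  let ?Q = "conf_quantile \<alpha> (sel_c_plus \<kappa> g C U \<omega>) (R \<omega>)"
  have SU: "S \<omega> \<subseteq> U" by (auto simp: sel_u_def)
  have finS: "finite (S \<omega>)" using SU fin(2) by (rule finite_subset)
  have "S \<omega> = {j \<in> U. ?r j \<in> {..<kh \<omega>}}" using mem_S_iff[OF \<omega>] by auto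
  then have cS: "card (S \<omega>) = kh \<omega>"
    using card_rank_vimage[OF fin(2) inj, of "{..<kh \<omega>}"] km by (simp add: subset_eq)
  have k1: "1 \<le> kh \<omega>" using kh_range[OF \<omega>] by simp
  have "(\<Sum>j\<in>S \<omega>. W j \<omega>) = (\<Sum>j\<in>S \<omega>. (of_bool (?Q < ereal (R \<omega> j)) - \<alpha>) / real (kh \<omega>))"
    using W_eq_of_selected[OF \<omega> _ hS km] by (intro sum.cong) auto
  also have "\<dots> = (real (card {j \<in> S \<omega>. ?Q < ereal (R \<omega> j)}) - real (kh \<omega>) * \<alpha>) / real (kh \<omega>)"
    using finS by (simp add: sum_divide_distrib[symmetric] sum_subtractf cS Int_def)
  also have "\<dots> = fcp \<alpha> mu g \<kappa> C U \<omega> - \<alpha>"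
    using k1 by (simp add: fcp_def Let_def cS diff_divide_distrib max_def)
  finally have eq: "(\<Sum>j\<in>S \<omega>. W j \<omega>) = fcp \<alpha> mu g \<kappa> C U \<omega> - \<alpha>" .
  have "(\<Sum>j\<in>U. W j \<omega>) = (\<Sum>j\<in>U - S \<omega>. W j \<omega>) + (\<Sum>j\<in>S \<omega>. W j \<omega>)"
    using SU fin(2) by (intro sum.subset_diff)
  then have "\<bar>fcp \<alpha> mu g \<kappa> C U \<omega> - \<alpha> - (\<Sum>j\<in>U. W j \<omega>)\<bar> = \<bar>\<Sum>j\<in>U - S \<omega>. W j \<omega>\<bar>"
    using eq by simp
  also have "\<dots> \<le> (\<Sum>j\<in>U - S \<omega>. of_bool (?r j \<in> {kh \<omega>..<kh \<omega> + I_u}) / M)"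
  proof (intro order_trans[OF sum_abs] sum_mono)
    fix j assume j: "j \<in> U - S \<omega>"
    have "\<bar>W j \<omega>\<bar> \<le> of_bool (l j \<omega> j < h j \<omega>) / real (h j \<omega>)"
      unfolding W_def by (rule abs_excess_le[OF \<alpha>])
    also have "\<dots> \<le> of_bool (?r j \<in> {kh \<omega>..<kh \<omega> + I_u}) / M"
      using j hU[OF j] M mem_S_iff[OF \<omega>, of j] by (auto simp: l_self intro!: frac_le)
    finally show "\<bar>W j \<omega>\<bar> \<le> of_bool (?r j \<in> {kh \<omega>..<kh \<omega> + I_u}) / M" .
  qed
  also have "\<dots> \<le> (\<Sum>j\<in>U. of_bool (?r j \<in> {kh \<omega>..<kh \<omega> + I_u}) / M)"
    using fin M by (intro sum_mono2) auto
  also have "\<dots> = real (card {j \<in> U. ?r j \<in> {kh \<omega>..<kh \<omega> + I_u}}) / M"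
    using fin by (simp add: sum_divide_distrib[symmetric] Int_def)
  also have "\<dots> \<le> real I_u / M"
    using card_rank_vimage_le[OF fin(2) inj, of "{kh \<omega>..<kh \<omega> + I_u}"] M
    by (intro divide_right_mono) auto
  finally show ?thesis .
qed

section \<open>Exchanging a test point with a calibration point\<close>

lemma distr_swap:
  assumes "j \<in> C \<union> U" "k \<in> C \<union> U"
  shows "distr \<Omega> \<Omega> (swap j k) = \<Omega>"
proof -
  have "bij_betw (Transposition.transpose j k) (C \<union> U) (C \<union> U)"
    using assms by (simp add: bij_betw_transpose_iff)
  then have "inj_on (Transposition.transpose j k) (C \<union> U)" "Transposition.transpose j k \<in> (C \<union> U) \<rightarrow> (C \<union> U)"
    by (auto simp: bij_betw_def)
  then show ?thesis
    using distr_PiM_reindex[of "C \<union> U" "\<lambda>_. P" "Transposition.transpose j k" "C \<union> U"] prob_space_axioms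
    by (simp add: swap_def[abs_def])
qed

lemma measurable_swap:
  assumes "j \<in> C \<union> U" "k \<in> C \<union> U"
  shows "swap j k \<in> measurable \<Omega> \<Omega>"
  unfolding swap_def[abs_def]
proof (rule measurable_restrict)
  fix i assume "i \<in> C \<union> U"
  then have "Transposition.transpose j k i \<in> C \<union> U" using assms by (auto simp: Transposition.transpose_def)
  then show "(\<lambda>\<omega>. \<omega> (Transposition.transpose j k i)) \<in> measurable \<Omega> P"
    by (rule measurable_component_singleton)
qed

text \<open>The exchange does not touch the test scores other than that of \<open>j\<close>, and
  permutes the points of \<open>insert j C\<close>. So ranks and residuals are merely relabelled,
  and only the threshold is still evaluated at the exchanged sample.\<close>

lemma W_swap:
  assumes j: "j \<in> U" and k: "k \<in> insert j C"
  shows "W j (swap j k \<omega>) = excess \<alpha> (l j \<omega>) (R \<omega>) (insert j C) (h j (swap j k \<omega>)) k"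
proof -
  let ?\<sigma> = "Transposition.transpose j k"
  have T: "T (swap j k \<omega>) i = T \<omega> (?\<sigma> i)" if "i \<in> C \<union> U" for i
    using that by (simp add: swap_def score_def)
  have Tv: "T (swap j k \<omega>) v = T \<omega> v" if "v \<in> U - {j}" for v
  proof -
    have "v \<noteq> k" using that k disj by auto
    then show ?thesis using that T[of v] by simp
  qed
  have l: "l j (swap j k \<omega>) i = l j \<omega> (?\<sigma> i)" if "i \<in> insert j C" for i
  proof -
    have "{v \<in> U - {j}. T (swap j k \<omega>) v < T (swap j k \<omega>) i} = {v \<in> U - {j}. T \<omega> v < T \<omega> (?\<sigma> i)}"
      using Tv T[of i] that j by auto
    then show ?thesis by (simp add: l_def)
  qed
  have R: "R (swap j k \<omega>) i = R \<omega> (?\<sigma> i)" if "i \<in> insert j C" for i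
    using that j by (auto simp: swap_def resid_def)
  have bij: "bij_betw ?\<sigma> (insert j C) (insert j C)" using k by (simp add: bij_betw_transpose_iff)
  have "excess \<alpha> (l j (swap j k \<omega>)) (R (swap j k \<omega>)) (insert j C) (h j (swap j k \<omega>)) j =
      excess \<alpha> (l j \<omega>) (R \<omega>) (insert j C) (h j (swap j k \<omega>)) (?\<sigma> j)"
    by (rule excess_relabel[OF bij]) (simp_all add: l R)
  then show ?thesis by (simp add: W_def)
qed

text \<open>The two exchanged scores are precisely the ones overwritten by constants.\<close>

lemma khat_rep2_swap:
  assumes "j \<in> U" "k \<in> C"
  shows "khat_rep2 \<kappa> g C U (swap j k \<omega>) j t k s = khat_rep2 \<kappa> g C U \<omega> j t k s"
proof -
  have "(score_vec g (C \<union> U) (swap j k \<omega>))(j := t, k := s) = (score_vec g (C \<union> U) \<omega>)(j := t, k := s)"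
    by (auto simp: fun_eq_iff score_vec_def score_def swap_def Transposition.transpose_def)
  then show ?thesis by (simp add: khat_rep2_def)
qed

lemma AE_h_ge:
  "AE \<omega> in \<Omega>. \<forall>j\<in>U. \<gamma> * real (card U) \<le> real (h j \<omega>)"
  using stable AE_space
proof eventually_elim
  case (elim \<omega>)
  have k: "\<gamma> * real (card U) \<le> real (kh \<omega>)" using elim by linarith
  show ?case
  proof
    fix j assume "j \<in> U"
    then have "kh \<omega> \<le> h j \<omega>" using elim unfolding h_def by (cases "j \<in> S \<omega>") auto
    then show "\<gamma> * real (card U) \<le> real (h j \<omega>)" using k by linarith
  qed
qed

text \<open>The double replacement is the same for the original and the exchanged sample, and
  exceeds the single replacement of either by at most \<open>I_c\<close>; so the two thresholds
  differ by at most \<open>I_c\<close>. Almost sure statements pass to the exchanged sample by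
  invariance of the law.\<close>

lemma AE_h_swap:
  assumes j: "j \<in> U" and k: "k \<in> insert j C"
  shows "AE \<omega> in \<Omega>. \<gamma> * real (card U) \<le> real (h j (swap j k \<omega>)) \<and>
    h j (swap j k \<omega>) \<le> h j \<omega> + I_c \<and> h j \<omega> \<le> h j (swap j k \<omega>) + I_c"
proof -
  have jk: "j \<in> C \<union> U" "k \<in> C \<union> U" using j k by auto
  have *: "AE \<omega> in \<Omega>. \<gamma> * real (card U) \<le> real (h j \<omega>) \<and> (\<forall>k\<in>C. h j \<omega> \<le> khat_rep2 \<kappa> g C U \<omega> j t_u k t_c \<and>
      khat_rep2 \<kappa> g C U \<omega> j t_u k t_c \<le> h j \<omega> + I_c)"
    using stable AE_h_ge by eventually_elim (use j in \<open>auto simp: h_def\<close>)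
  then have "AE \<omega> in distr \<Omega> \<Omega> (swap j k). \<gamma> * real (card U) \<le> real (h j \<omega>) \<and> (\<forall>k\<in>C. h j \<omega> \<le> khat_rep2 \<kappa> g C U \<omega> j t_u k t_c \<and>
      khat_rep2 \<kappa> g C U \<omega> j t_u k t_c \<le> h j \<omega> + I_c)"
    unfolding distr_swap[OF jk] .
  then have "AE \<omega> in \<Omega>. \<gamma> * real (card U) \<le> real (h j (swap j k \<omega>)) \<and> (\<forall>k'\<in>C. h j (swap j k \<omega>) \<le> khat_rep2 \<kappa> g C U (swap j k \<omega>) j t_u k' t_c \<and>
      khat_rep2 \<kappa> g C U (swap j k \<omega>) j t_u k' t_c \<le> h j (swap j k \<omega>) + I_c)"
    by (rule AE_distrD[OF measurable_swap[OF jk]])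
  with * AE_space show ?thesis
  proof eventually_elim
    case (elim \<omega>)
    show ?case
    proof (cases "k = j")
      case True
      then have "swap j k \<omega> = \<omega>" using elim(2) by (auto simp: swap_def fun_eq_iff space_PiM PiE_def extensional_def)
      then show ?thesis using elim by simp
    next
      case False
      then have kC: "k \<in> C" using k by simp
      have "h j (swap j k \<omega>) \<le> khat_rep2 \<kappa> g C U \<omega> j t_u k t_c"
        "khat_rep2 \<kappa> g C U \<omega> j t_u k t_c \<le> h j (swap j k \<omega>) + I_c"
        using elim(3) kC khat_rep2_swap[OF j kC, of \<omega> t_u t_c] by auto
      moreover have "h j \<omega> \<le> khat_rep2 \<kappa> g C U \<omega> j t_u k t_c" "khat_rep2 \<kappa> g C U \<omega> j t_u k t_c \<le> h j \<omega> + I_c"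
        using elim(1) kC by auto
      ultimately show ?thesis using elim(3) by auto
    qed
  qed
qed

lemma integrable_W: "j \<in> U \<Longrightarrow> integrable \<Omega> (W j)"
proof (rule \<Omega>.integrable_const_bound[of _ 1])
  have "\<bar>W j \<omega>\<bar> \<le> 1" for \<omega>
  proof -
    have "\<bar>W j \<omega>\<bar> \<le> of_bool (l j \<omega> j < h j \<omega>) / real (h j \<omega>)"
      unfolding W_def by (rule abs_excess_le[OF \<alpha>])
    also have "\<dots> \<le> 1" by auto
    finally show ?thesis .
  qed
  then show "AE \<omega> in \<Omega>. norm (W j \<omega>) \<le> 1" by simp
qed (rule measurable_W)

lemma integral_W_swap:
  assumes j: "j \<in> U" and k: "k \<in> insert j C"
  shows "(\<integral>\<omega>. W j (swap j k \<omega>) \<partial>\<Omega>) = (\<integral>\<omega>. W j \<omega> \<partial>\<Omega>)" "integrable \<Omega> (\<lambda>\<omega>. W j (swap j k \<omega>))"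
proof -
  have jk: "j \<in> C \<union> U" "k \<in> C \<union> U" using j k by auto
  note m = measurable_swap[OF jk] and d = distr_swap[OF jk]
  show "(\<integral>\<omega>. W j (swap j k \<omega>) \<partial>\<Omega>) = (\<integral>\<omega>. W j \<omega> \<partial>\<Omega>)"
    using integral_distr[OF m measurable_W[OF j]] by (simp add: d)
  show "integrable \<Omega> (\<lambda>\<omega>. W j (swap j k \<omega>))"
    using integrable_distr_eq[OF m measurable_W[OF j]] integrable_W[OF j] by (simp add: d)
qed

section \<open>Expected window size and the expectation of a single term\<close>

text \<open>Counts the points whose comparison with the threshold can be reversed by a shift of at
  most \<open>I_c\<close>.\<close>

definition D :: "nat \<Rightarrow> sample \<Rightarrow> nat" where
  "D j \<omega> = card {i \<in> insert j C. h j \<omega> \<le> l j \<omega> i + I_c \<and> l j \<omega> i < h j \<omega> + I_c}"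

lemma measurable_D: "j \<in> U \<Longrightarrow> D j \<in> measurable \<Omega> (count_space UNIV)"
  unfolding D_def[abs_def]
proof (rule measurable_card_filter)
  fix i assume "j \<in> U" "i \<in> insert j C"
  then have "i \<in> C \<union> U" by auto
  from sets_Collect_nat_pair[OF measurable_h[OF \<open>j \<in> U\<close>] measurable_l[OF this],
      of "\<lambda>a b. a \<le> b + I_c \<and> b < a + I_c"]
  show "{\<omega> \<in> space \<Omega>. h j \<omega> \<le> l j \<omega> i + I_c \<and> l j \<omega> i < h j \<omega> + I_c} \<in> sets \<Omega>" .
qed

text \<open>The factor \<open>of_bool\<close> records that the window is empty for
  \<open>I_c = 0\<close>; this later allows the term coming from large gaps to be charged to a
  multiple of \<open>I_c\<close>.\<close>

lemma nn_integral_D_le: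
  assumes j: "j \<in> U" and x: "0 < x"
  shows "(\<integral>\<^sup>+\<omega>. ennreal (real (D j \<omega>)) \<partial>\<Omega>) \<le> ennreal (of_bool (0 < I_c) *
    (ln (real (card C + 1)) + 2 + 4 * real I_c * x * real (card C + 1)
        + real (card C + 1) * (real (card U) * exp (- x * (real (card U) - 2)))))"
proof (cases "I_c = 0")
  case True
  have "{i \<in> insert j C. h j \<omega> \<le> l j \<omega> i + I_c \<and> l j \<omega> i < h j \<omega> + I_c} = {}" for \<omega>
    using True by auto
  then have "D j \<omega> = 0" for \<omega> unfolding D_def by (simp only: card.empty)
  then show ?thesis by simp
next
  case False
  have "j \<notin> C" using j disj by auto
  then have c1: "card (insert j C) = card C + 1" using fin by simp
  have c2: "real (card (U - {j})) = real (card U) - 1"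
    using card_Suc_Diff1[OF fin(2) j] by linarith
  have "(\<integral>\<^sup>+\<omega>. ennreal (real (D j \<omega>)) \<partial>\<Omega>) \<le> ennreal (ln (real (card (insert j C))) + 2 + 4 * real I_c * x * real (card (insert j C))
        + real (card (insert j C)) * ((real (card (U - {j})) + 1) * exp (- x * (real (card (U - {j})) - 1))))"
    unfolding D_def l_def score_def
    by (rule nn_integral_card_rank_window_le[where j = j]) (use measurable_g cont_T fin j x in auto)
  then show ?thesis using False unfolding c1 c2 by simp
qed

text \<open>By invariance all \<open>card C + 1\<close> exchanged terms have the same expectation.
  Their sum is bounded pointwise by \<open>sum_excess_perturbed_le\<close>, with the exchanged
  thresholds as \<open>h'\<close>, and then averaged.\<close>

lemma abs_integral_W_le:
  assumes j: "j \<in> U" and E: "0 \<le> E" "(\<integral>\<^sup>+\<omega>. ennreal (real (D j \<omega>)) \<partial>\<Omega>) \<le> ennreal E"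
  defines "M \<equiv> \<gamma> * real (card U)"
  shows "real (card C + 1) * \<bar>\<integral>\<omega>. W j \<omega> \<partial>\<Omega>\<bar> \<le> (1 + 5 * E) / M + real (card C + 1) * real I_c / M\<^sup>2"
proof -
  let ?B = "insert j C"
  have finB: "finite ?B" using fin by simp
  have "j \<notin> C" using j disj by auto
  then have cB: "card ?B = card C + 1" using fin by simp
  have "0 < card U" using j fin(2) card_gt_0_iff by blast
  then have M0: "0 < M" using \<gamma> by (simp add: M_def)
  define c where "c = 1 / M + real (card ?B) * real I_c / M\<^sup>2"
  have c0: "0 \<le> c" using M0 by (simp add: c_def)
  have "AE \<omega> in \<Omega>. \<forall>k\<in>?B. M \<le> real (h j (swap j k \<omega>)) \<and>
      h j (swap j k \<omega>) \<le> h j \<omega> + I_c \<and> h j \<omega> \<le> h j (swap j k \<omega>) + I_c"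
    unfolding M_def by (intro AE_ball_countable' AE_h_swap j countable_finite finB)
  moreover have "AE \<omega> in \<Omega>. inj_on (R \<omega>) (C \<union> U)"
    unfolding resid_def[abs_def] using fin by (intro AE_PiM_inj_on[OF measurable_r cont_R]) auto
  ultimately have bound: "AE \<omega> in \<Omega>. \<bar>\<Sum>k\<in>?B. W j (swap j k \<omega>)\<bar> \<le> c + 5 / M * real (D j \<omega>)"
    using AE_h_ge
  proof eventually_elim
    case (elim \<omega>)
    have "inj_on (R \<omega>) ?B" by (rule inj_on_subset[OF elim(2)]) (use j in auto)
    then have "\<bar>\<Sum>k\<in>?B. excess \<alpha> (l j \<omega>) (R \<omega>) ?B (h j (swap j k \<omega>)) k\<bar> \<le>
        (1 + 5 * real (D j \<omega>)) / M + real (card ?B) * real I_c / M\<^sup>2"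
      unfolding D_def using elim j
      by (intro sum_excess_perturbed_le[OF finB _ \<alpha> M0]) (auto simp: M_def)
    moreover have "(\<Sum>k\<in>?B. W j (swap j k \<omega>)) = (\<Sum>k\<in>?B. excess \<alpha> (l j \<omega>) (R \<omega>) ?B (h j (swap j k \<omega>)) k)"
      by (intro sum.cong W_swap j) auto
    ultimately show ?case by (simp add: c_def add_divide_distrib)
  qed
  have int: "integrable \<Omega> (\<lambda>\<omega>. \<Sum>k\<in>?B. W j (swap j k \<omega>))"
    by (intro Bochner_Integration.integrable_sum integral_W_swap(2) j)
  have "real (card ?B) * (\<integral>\<omega>. W j \<omega> \<partial>\<Omega>) = (\<Sum>k\<in>?B. \<integral>\<omega>. W j (swap j k \<omega>) \<partial>\<Omega>)"
    using integral_W_swap(1)[OF j] by simp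
  also have "\<dots> = (\<integral>\<omega>. (\<Sum>k\<in>?B. W j (swap j k \<omega>)) \<partial>\<Omega>)"
    by (intro Bochner_Integration.integral_sum[symmetric] integral_W_swap(2) j)
  finally have "real (card ?B) * \<bar>\<integral>\<omega>. W j \<omega> \<partial>\<Omega>\<bar> = \<bar>\<integral>\<omega>. (\<Sum>k\<in>?B. W j (swap j k \<omega>)) \<partial>\<Omega>\<bar>"
    by (metis abs_mult abs_of_nat)
  also have "\<dots> \<le> (\<integral>\<omega>. \<bar>\<Sum>k\<in>?B. W j (swap j k \<omega>)\<bar> \<partial>\<Omega>)" by (rule integral_abs_bound)
  finally have le1: "real (card ?B) * \<bar>\<integral>\<omega>. W j \<omega> \<partial>\<Omega>\<bar> \<le> (\<integral>\<omega>. \<bar>\<Sum>k\<in>?B. W j (swap j k \<omega>)\<bar> \<partial>\<Omega>)" .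
  have Dm: "(\<lambda>\<omega>. ennreal (real (D j \<omega>))) \<in> borel_measurable \<Omega>"
    using measurable_compose[OF measurable_D[OF j], of "\<lambda>n. ennreal (real n)" borel] by simp
  have "ennreal (\<integral>\<omega>. \<bar>\<Sum>k\<in>?B. W j (swap j k \<omega>)\<bar> \<partial>\<Omega>) = (\<integral>\<^sup>+\<omega>. ennreal \<bar>\<Sum>k\<in>?B. W j (swap j k \<omega>)\<bar> \<partial>\<Omega>)"
    using int by (intro nn_integral_eq_integral[symmetric]) auto
  also have "\<dots> \<le> (\<integral>\<^sup>+\<omega>. ennreal c + ennreal (5 / M) * ennreal (real (D j \<omega>)) \<partial>\<Omega>)"
  proof (rule nn_integral_mono_AE)
    show "AE \<omega> in \<Omega>. ennreal \<bar>\<Sum>k\<in>?B. W j (swap j k \<omega>)\<bar> \<le> ennreal c + ennreal (5 / M) * ennreal (real (D j \<omega>))"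
      using bound
    proof eventually_elim
      case (elim \<omega>)
      have "ennreal c + ennreal (5 / M) * ennreal (real (D j \<omega>)) = ennreal (c + 5 / M * real (D j \<omega>))"
        using c0 M0 by (simp add: ennreal_plus ennreal_mult[symmetric])
      then show ?case using elim by (simp add: ennreal_leI)
    qed
  qed
  also have "\<dots> = ennreal c + ennreal (5 / M) * (\<integral>\<^sup>+\<omega>. ennreal (real (D j \<omega>)) \<partial>\<Omega>)"
    using Dm by (simp add: nn_integral_add nn_integral_cmult \<Omega>.emeasure_space_1)
  also have "\<dots> \<le> ennreal c + ennreal (5 / M) * ennreal E"
    using E by (intro add_left_mono mult_left_mono) auto
  also have "\<dots> = ennreal (c + 5 / M * E)" using c0 M0 E by (simp add: ennreal_plus ennreal_mult[symmetric])
  finally have "(\<integral>\<omega>. \<bar>\<Sum>k\<in>?B. W j (swap j k \<omega>)\<bar> \<partial>\<Omega>) \<le> c + 5 / M * E"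
    using c0 M0 E by (subst (asm) ennreal_le_iff) auto
  then show ?thesis using le1 by (simp add: c_def cB add_divide_distrib)
qed

section \<open>Summation over test points and explicit constants\<close>

lemma FCR_minus_sum_integral_W_le:
  assumes U: "U \<noteq> {}"
  shows "\<bar>FCR P \<alpha> mu g \<kappa> C U - \<alpha> - (\<Sum>j\<in>U. \<integral>\<omega>. W j \<omega> \<partial>\<Omega>)\<bar> \<le> real I_u / (\<gamma> * real (card U))"
proof -
  have M0: "0 < \<gamma> * real (card U)" using \<gamma> U fin by (auto simp: card_gt_0_iff)
  have fcp01: "0 \<le> fcp \<alpha> mu g \<kappa> C U \<omega>" "fcp \<alpha> mu g \<kappa> C U \<omega> \<le> 1" for \<omega>
  proof -
    have "finite (S \<omega>)" using fin by (simp add: sel_u_def)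
    then have "card {j \<in> S \<omega>. Q j} \<le> max (card (S \<omega>)) 1" for Q
      using card_mono[of "S \<omega>" "{j \<in> S \<omega>. Q j}"] by fastforce
    then show "0 \<le> fcp \<alpha> mu g \<kappa> C U \<omega>" "fcp \<alpha> mu g \<kappa> C U \<omega> \<le> 1" 
      unfolding fcp_def Let_def by (auto intro!: divide_le_eq_1_pos[THEN iffD2])
  qed
  have int: "integrable \<Omega> (fcp \<alpha> mu g \<kappa> C U)"
    using fcp01 by (intro \<Omega>.integrable_const_bound[of _ 1] measurable_fcp) auto
  have "AE \<omega> in \<Omega>. inj_on (T \<omega>) (C \<union> U)"
    unfolding score_def[abs_def] using fin by (intro AE_PiM_inj_on[OF measurable_g cont_T]) auto
  then have bound: "AE \<omega> in \<Omega>. \<bar>fcp \<alpha> mu g \<kappa> C U \<omega> - \<alpha> - (\<Sum>j\<in>U. W j \<omega>)\<bar> \<le> real I_u / (\<gamma> * real (card U))"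
    using stable AE_space
  proof eventually_elim
    case (elim \<omega>)
    have "inj_on (T \<omega>) U" using elim(1) by (auto intro: inj_on_subset)
    moreover have "kh \<omega> < card U" "\<gamma> * real (card U) \<le> real (kh \<omega>)" using elim(2) by linarith+
    ultimately show ?case
      using elim M0 by (intro fcp_minus_sum_W_le) (auto simp: h_def)
  qed
  have intd: "integrable \<Omega> (\<lambda>\<omega>. fcp \<alpha> mu g \<kappa> C U \<omega> - \<alpha> - (\<Sum>j\<in>U. W j \<omega>))"
    using int integrable_W by (intro Bochner_Integration.integrable_diff Bochner_Integration.integrable_sum) auto
  have eq: "FCR P \<alpha> mu g \<kappa> C U - \<alpha> - (\<Sum>j\<in>U. \<integral>\<omega>. W j \<omega> \<partial>\<Omega>) = (\<integral>\<omega>. fcp \<alpha> mu g \<kappa> C U \<omega> - \<alpha> - (\<Sum>j\<in>U. W j \<omega>) \<partial>\<Omega>)"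
    using int integrable_W by (simp add: FCR_def \<Omega>.prob_space)
  have "\<bar>\<integral>\<omega>. fcp \<alpha> mu g \<kappa> C U \<omega> - \<alpha> - (\<Sum>j\<in>U. W j \<omega>) \<partial>\<Omega>\<bar> \<le> (\<integral>\<omega>. \<bar>fcp \<alpha> mu g \<kappa> C U \<omega> - \<alpha> - (\<Sum>j\<in>U. W j \<omega>)\<bar> \<partial>\<Omega>)" by (rule integral_abs_bound)
  also have "\<dots> \<le> (\<integral>\<omega>. real I_u / (\<gamma> * real (card U)) \<partial>\<Omega>)"
    by (rule integral_mono_AE[OF integrable_abs[OF intd] _ bound]) (rule \<Omega>.integrable_const)
  also have "\<dots> = real I_u / (\<gamma> * real (card U))" by (simp add: \<Omega>.prob_space)
  finally show ?thesis unfolding eq .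
qed

text \<open>Almost surely the threshold lies between 1 and \<open>card U - 1\<close>, and an event
  of probability one is not empty.\<close>

lemma card_U_ge_2: "2 \<le> card U"
proof -
  have "AE \<omega> in \<Omega>. 2 \<le> card U"
    using stable AE_space
  proof eventually_elim
    case (elim \<omega>)
    then show ?case using kh_range[OF elim(2)] by linarith
  qed
  then show ?thesis by simp
qed

lemma abs_FCR_minus_le:
  assumes n: "2 \<le> card C" and m: "4 \<le> card U"
  defines "a \<equiv> ln (real (card C)) / real (card C)" and "b \<equiv> ln (real (card U)) / real (card U)"
  shows "\<bar>FCR P \<alpha> mu g \<kappa> C U - \<alpha>\<bar> \<le>
    2 * (real I_u * b / \<gamma>) + (32 * a + 90 * (real I_c * b)) / \<gamma> + 2 * (real I_c * b) / \<gamma>\<^sup>2"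
proof -
  define N where "N = real (card C)"
  define m' where "m' = real (card U)"
  \<comment> \<open>With this gap length the exponential in the large-gap bound is
    \<open>1 / m'^2\<close>, so the expected cost per calibration point is
    \<open>1 / m'\<close>.\<close>
  define x where "x = 2 * ln m' / (m' - 2)"
  define i where "i = real I_c"
  define E where "E = of_bool (0 < I_c) * (ln (real (card C + 1)) + 2 + 4 * real I_c * x * real (card C + 1)
        + real (card C + 1) * (real (card U) * exp (- x * (real (card U) - 2))))"
  have N2: "2 \<le> N" and m4: "4 \<le> m'" using n m by (simp_all add: N_def m'_def)
  have lnN: "1 / 2 \<le> ln N" and lnm: "1 / 2 \<le> ln m'"
    using half_le_ln[of "card C"] half_le_ln[of "card U"] n m by (simp_all add: N_def m'_def)
  have x0: "0 < x" using lnm m4 by (simp add: x_def)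
  have E0: "0 \<le> E" using x0 by (simp add: E_def)
  have a: "1 / (N + 1) \<le> 2 * a" "ln (N + 1) / (N + 1) \<le> 2 * a"
  proof -
    have "1 / (N + 1) \<le> (2 * ln N) / N" using lnN N2 by (intro frac_le) auto
    then show "1 / (N + 1) \<le> 2 * a" by (simp add: a_def N_def)
    have "2 * N \<le> N * N" using N2 by (intro mult_right_mono) auto
    then have "N + 1 \<le> N * N" using N2 by linarith
    then have "ln (N + 1) \<le> ln (N * N)" using N2 by (subst ln_le_cancel_iff) auto
    also have "\<dots> = 2 * ln N" using N2 by (simp add: ln_mult)
    finally have "ln (N + 1) / (N + 1) \<le> (2 * ln N) / N" using N2 by (intro frac_le) auto
    then show "ln (N + 1) / (N + 1) \<le> 2 * a" by (simp add: a_def N_def)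
  qed
  have b: "1 / m' \<le> 2 * b" "x \<le> 4 * b"
  proof -
    have "1 / m' \<le> (2 * ln m') / m'" using lnm m4 by (intro divide_right_mono) auto
    then show "1 / m' \<le> 2 * b" by (simp add: b_def m'_def)
    have "x \<le> 2 * ln m' / (m' / 2)" unfolding x_def using lnm m4 by (intro divide_left_mono) auto
    then show "x \<le> 4 * b" by (simp add: b_def m'_def)
  qed
  have b0: "0 \<le> b" and a0: "0 \<le> a" using lnm lnN m4 N2 by (simp_all add: a_def b_def N_def m'_def)
  have ex: "m' * exp (- x * (m' - 2)) = 1 / m'"
  proof -
    have "- x * (m' - 2) = - ln (m' * m')" using m4 by (simp add: x_def ln_mult)
    then have "exp (- x * (m' - 2)) = inverse (m' * m')"
      using m4 by (simp only: exp_minus) simp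
    then show ?thesis using m4 by (simp only:) (simp add: field_simps)
  qed
  \<comment> \<open>The logarithm and the constant 2 give \<open>2 * a + 4 * a\<close>, the window
    gives \<open>16 * i * b\<close>, and the large gaps give at most \<open>2 * b\<close>, which is
    charged to \<open>2 * i * b\<close> because \<open>i\<close> is at least 1 whenever
    \<open>E\<close> is not zero.\<close>
  have E1: "E / (N + 1) \<le> 6 * a + 18 * (i * b)"
  proof (cases "I_c = 0")
    case False
    then have i1: "1 \<le> i" by (simp add: i_def)
    have E_eq: "E = ln (N + 1) + 2 + 4 * i * x * (N + 1) + (N + 1) * (1 / m')"
      using False ex by (simp add: E_def N_def i_def m'_def add.commute)
    have frac: "(p + 2 + q * c + c * r) / c = p / c + 2 * (1 / c) + q + r" if "c \<noteq> 0" for p q c r :: real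
      using that by (simp add: add_divide_distrib)
    have "E / (N + 1) = ln (N + 1) / (N + 1) + 2 * (1 / (N + 1)) + 4 * i * x + 1 / m'"
      unfolding E_eq by (rule frac) (use N2 in simp)
    moreover have "i * x \<le> i * (4 * b)" using b i1 by (intro mult_left_mono) auto
    moreover have "1 * b \<le> i * b" using i1 b0 by (intro mult_right_mono)
    ultimately show ?thesis using a b by linarith
  qed (use a0 in \<open>simp add: E_def i_def\<close>)
  have W: "\<bar>\<integral>\<omega>. W j \<omega> \<partial>\<Omega>\<bar> \<le> ((32 * a + 90 * (i * b)) / \<gamma> + 2 * (i * b) / \<gamma>\<^sup>2) / m'" if j: "j \<in> U" for j
  proof -
    have "(N + 1) * \<bar>\<integral>\<omega>. W j \<omega> \<partial>\<Omega>\<bar> \<le> (1 + 5 * E) / (\<gamma> * m') + (N + 1) * i / (\<gamma> * m')\<^sup>2"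
      using abs_integral_W_le[OF j E0 nn_integral_D_le[OF j x0, folded E_def]]
      by (simp add: N_def m'_def i_def add.commute)
    then have "\<bar>\<integral>\<omega>. W j \<omega> \<partial>\<Omega>\<bar> \<le> ((1 + 5 * E) / (\<gamma> * m') + (N + 1) * i / (\<gamma> * m')\<^sup>2) / (N + 1)"
      using N2 by (subst pos_le_divide_eq) (auto simp: mult.commute)
    also have "\<dots> = ((1 / (N + 1) + 5 * (E / (N + 1))) / \<gamma> + i * (1 / m') / \<gamma>\<^sup>2) / m'"
    proof -
      have "((1 + 5 * E) / (\<gamma> * m') + c * i / (\<gamma> * m')\<^sup>2) / c =
          ((1 / c + 5 * (E / c)) / \<gamma> + i * (1 / m') / \<gamma>\<^sup>2) / m'" if "c \<noteq> 0" for c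
        using that by (simp add: add_divide_distrib power2_eq_square mult_ac)
      then show ?thesis using N2 by simp
    qed
    also have "\<dots> \<le> ((32 * a + 90 * (i * b)) / \<gamma> + (i * (2 * b)) / \<gamma>\<^sup>2) / m'"
    proof -
      \<comment> \<open>\<open>2 * a\<close> from the first summand plus five times
        \<open>6 * a + 18 * (i * b)\<close>.\<close>
      have "1 / (N + 1) + 5 * (E / (N + 1)) \<le> 32 * a + 90 * (i * b)" using a E1 by linarith
      then have "(1 / (N + 1) + 5 * (E / (N + 1))) / \<gamma> \<le> (32 * a + 90 * (i * b)) / \<gamma>"
        using \<gamma> by (intro divide_right_mono) auto
      moreover have "i * (1 / m') / \<gamma>\<^sup>2 \<le> i * (2 * b) / \<gamma>\<^sup>2"
        using b by (intro divide_right_mono mult_left_mono) (auto simp: i_def)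
      ultimately show ?thesis by (rule divide_right_mono[OF add_mono]) (use m4 in simp)
    qed
    finally show ?thesis by (simp add: mult.left_commute)
  qed
  have "\<bar>\<Sum>j\<in>U. \<integral>\<omega>. W j \<omega> \<partial>\<Omega>\<bar> \<le> (\<Sum>j\<in>U. ((32 * a + 90 * (i * b)) / \<gamma> + 2 * (i * b) / \<gamma>\<^sup>2) / m')"
    by (intro order_trans[OF sum_abs] sum_mono W)
  \<comment> \<open>There are \<open>m'\<close> test points, which cancels the factor
    \<open>1 / m'\<close> of each term.\<close>
  also have "\<dots> = (32 * a + 90 * (i * b)) / \<gamma> + 2 * (i * b) / \<gamma>\<^sup>2"
    using m4 by (simp add: m'_def)
  finally have "\<bar>\<Sum>j\<in>U. \<integral>\<omega>. W j \<omega> \<partial>\<Omega>\<bar> \<le> (32 * a + 90 * (i * b)) / \<gamma> + 2 * (i * b) / \<gamma>\<^sup>2" .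
  moreover have "\<bar>FCR P \<alpha> mu g \<kappa> C U - \<alpha> - (\<Sum>j\<in>U. \<integral>\<omega>. W j \<omega> \<partial>\<Omega>)\<bar> \<le> 2 * (real I_u * b / \<gamma>)"
  proof -
    have "U \<noteq> {}" using m by auto
    then have "\<bar>FCR P \<alpha> mu g \<kappa> C U - \<alpha> - (\<Sum>j\<in>U. \<integral>\<omega>. W j \<omega> \<partial>\<Omega>)\<bar> \<le> real I_u * (1 / m') / \<gamma>"
      using FCR_minus_sum_integral_W_le by (simp add: m'_def mult.commute)
    also have "\<dots> \<le> real I_u * (2 * b) / \<gamma>"
      using b \<gamma> by (intro divide_right_mono mult_left_mono) auto
    finally show ?thesis by (simp add: mult.left_commute)
  qed
  ultimately show ?thesis unfolding i_def by linarith
qed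

end

section \<open>The rate with constant 92\<close>

theorem theorem3:
  shows "\<exists>K::real. \<forall>(d::nat) (n::nat) (m::nat) (C::nat set) (U::nat set) (P::point measure)
      (mu::(nat \<Rightarrow> real) \<Rightarrow> real) (g::(nat \<Rightarrow> real) \<Rightarrow> real) (\<kappa>::(nat \<Rightarrow> real) \<Rightarrow> nat)
      (\<alpha>::real) (\<gamma>::real) (\<rho>::real) (t_u::real) (t_c::real) (I_u::nat) (I_c::nat).
    finite C \<and> finite U \<and> C \<inter> U = {} \<and> card C = n \<and> card U = m \<and> n \<ge> 2 \<and>
    prob_space P \<and> sets P = sets (point_space d) \<and>
    mu \<in> borel_measurable (feature_space d) \<and> g \<in> borel_measurable (feature_space d) \<and>
    \<kappa> \<in> measurable (\<Pi>\<^sub>M i\<in>C \<union> U. (borel :: real measure)) (count_space UNIV) \<and>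
    (\<forall>v \<in> space (\<Pi>\<^sub>M i\<in>C \<union> U. (borel :: real measure)). \<kappa> v \<in> {1..m}) \<and>
    0 < \<alpha> \<and> \<alpha> < 1 \<and>
    \<comment> \<open>continuity of scores and residuals\<close>
    (\<forall>t. measure P {z \<in> space P. g (fst z) = t} = 0) \<and>
    (\<forall>r. measure P {z \<in> space P. \<bar>snd z - mu (fst z)\<bar> = r} = 0) \<and>
    \<comment> \<open>assumption (A)\<close>
    0 < \<gamma> \<and> \<gamma> < 1 \<and>
    (AE \<omega> in (\<Pi>\<^sub>M i\<in>C \<union> U. P).
       (\<forall>j \<in> sel_u \<kappa> g C U \<omega>. khat_rep1 \<kappa> g C U \<omega> j t_u = khat \<kappa> g C U \<omega>) \<and>
       (\<forall>j \<in> U - sel_u \<kappa> g C U \<omega>. khat \<kappa> g C U \<omega> \<le> khat_rep1 \<kappa> g C U \<omega> j t_u \<and>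
            khat_rep1 \<kappa> g C U \<omega> j t_u \<le> khat \<kappa> g C U \<omega> + I_u) \<and>
       (\<forall>j \<in> U. \<forall>k \<in> C. khat_rep1 \<kappa> g C U \<omega> j t_u \<le> khat_rep2 \<kappa> g C U \<omega> j t_u k t_c \<and>
            khat_rep2 \<kappa> g C U \<omega> j t_u k t_c \<le> khat_rep1 \<kappa> g C U \<omega> j t_u + I_c) \<and>
       \<lceil>\<gamma> * real m\<rceil> \<le> int (khat \<kappa> g C U \<omega>) \<and>
       int (khat \<kappa> g C U \<omega>) \<le> int m - 1) \<and>
    \<comment> \<open>assumption (B)\<close>
    0 < \<rho> \<and> \<rho> < 1 \<and>
    (let F_R = (\<lambda>r. measure P {z \<in> space P. \<bar>snd z - mu (fst z)\<bar> \<le> r});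
         F_T = (\<lambda>t. measure P {z \<in> space P. g (fst z) \<le> t});
         H = (\<lambda>r t. measure P {z \<in> space P. F_R \<bar>snd z - mu (fst z)\<bar> \<le> r \<and> F_T (g (fst z)) \<le> t})
     in \<forall>t \<in> {\<gamma>/2..1}. \<forall>r \<in> {0<..<1}.
          \<exists>D. ((\<lambda>r'. H r' t) has_real_derivative D) (at r) \<and> D \<ge> \<rho> * t) \<and>
    real n * \<gamma> \<ge> 256 * ln (real n) \<and> real m * \<gamma> \<ge> 32 * ln (real m)
    \<longrightarrow>
    \<bar>FCR P \<alpha> mu g \<kappa> C U - \<alpha>\<bar> \<le>
      K * ((1 / (\<rho> * \<gamma> ^ 3)) * (real I_c * ln (real m) / real m + ln (real n) / real n)
           + real I_u * ln (real m) / (real m * \<gamma>))"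
proof (intro exI allI impI, elim conjE)
  fix d n m :: nat and C U :: "nat set" and P :: "point measure"
    and mu g :: "(nat \<Rightarrow> real) \<Rightarrow> real" and \<kappa> :: "(nat \<Rightarrow> real) \<Rightarrow> nat"
    and \<alpha> \<gamma> \<rho> t_u t_c :: real and I_u I_c :: nat
  assume P: "prob_space P" "sets P = sets (point_space d)"
    and CU: "finite C" "finite U" "C \<inter> U = {}" "card C = n" "card U = m" "2 \<le> n"
    and meas: "mu \<in> borel_measurable (feature_space d)" "g \<in> borel_measurable (feature_space d)"
      "\<kappa> \<in> measurable (\<Pi>\<^sub>M i\<in>C \<union> U. (borel :: real measure)) (count_space UNIV)"
    and range: "\<forall>v \<in> space (\<Pi>\<^sub>M i\<in>C \<union> U. (borel :: real measure)). \<kappa> v \<in> {1..m}"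
    and \<alpha>01: "0 < \<alpha>" "\<alpha> < 1"
    and cont: "\<forall>t. measure P {z \<in> space P. g (fst z) = t} = 0"
      "\<forall>r. measure P {z \<in> space P. \<bar>snd z - mu (fst z)\<bar> = r} = 0"
    and \<gamma>01: "0 < \<gamma>" "\<gamma> < 1" and \<rho>01: "0 < \<rho>" "\<rho> < 1"
    and m\<gamma>: "32 * ln (real m) \<le> real m * \<gamma>"
    and stab: "AE \<omega> in (\<Pi>\<^sub>M i\<in>C \<union> U. P).
       (\<forall>j \<in> sel_u \<kappa> g C U \<omega>. khat_rep1 \<kappa> g C U \<omega> j t_u = khat \<kappa> g C U \<omega>) \<and>
       (\<forall>j \<in> U - sel_u \<kappa> g C U \<omega>. khat \<kappa> g C U \<omega> \<le> khat_rep1 \<kappa> g C U \<omega> j t_u \<and>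
            khat_rep1 \<kappa> g C U \<omega> j t_u \<le> khat \<kappa> g C U \<omega> + I_u) \<and>
       (\<forall>j \<in> U. \<forall>k \<in> C. khat_rep1 \<kappa> g C U \<omega> j t_u \<le> khat_rep2 \<kappa> g C U \<omega> j t_u k t_c \<and>
            khat_rep2 \<kappa> g C U \<omega> j t_u k t_c \<le> khat_rep1 \<kappa> g C U \<omega> j t_u + I_c) \<and>
       \<lceil>\<gamma> * real m\<rceil> \<le> int (khat \<kappa> g C U \<omega>) \<and>
       int (khat \<kappa> g C U \<omega>) \<le> int m - 1"
  interpret prob_space P by fact
  interpret calibrated_selection P d C U mu g \<kappa> \<alpha> \<gamma> t_u t_c I_u I_c
    using P CU meas range \<alpha>01 cont \<gamma>01 stab by unfold_locales auto
  define a where "a = ln (real n) / real n"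
  define b where "b = ln (real m) / real m"
  define r where "r = 1 / (\<rho> * \<gamma> ^ 3)"
  have m2: "2 \<le> m" using card_U_ge_2 CU by simp
  \<comment> \<open>Since \<open>ln m\<close> is at least 1/2, the sample size condition forces
    \<open>m\<close> to be at least 16.\<close>
  have "real m * \<gamma> \<le> real m" using \<gamma>01 by (simp add: mult_left_le)
  then have m4: "4 \<le> m" using half_le_ln[OF m2] m\<gamma> by linarith
  have a0: "0 \<le> a" "0 \<le> real I_c * b" "0 \<le> real I_u * b / \<gamma>"
    using half_le_ln[OF m2] half_le_ln[OF CU(6)] \<gamma>01 by (simp_all add: a_def b_def)
  \<comment> \<open>All factors of \<rho> \<gamma>^3 are below 1, so \<open>r\<close> dominates the
    lower powers of 1 / \<gamma> that occur.\<close>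
  have r: "1 / \<gamma> \<le> r" "1 / \<gamma>\<^sup>2 \<le> r" "0 \<le> r"
  proof -
    have "\<rho> * \<gamma> ^ 3 \<le> 1 * \<gamma> ^ 2" using \<rho>01 \<gamma>01 by (intro mult_mono power_decreasing) auto
    then show "1 / \<gamma>\<^sup>2 \<le> r" unfolding r_def using \<rho>01 \<gamma>01 by (intro divide_left_mono) auto
    have "\<rho> * \<gamma> ^ 3 \<le> 1 * \<gamma> ^ 1" using \<rho>01 \<gamma>01 by (intro mult_mono power_decreasing) auto
    then show "1 / \<gamma> \<le> r" unfolding r_def using \<rho>01 \<gamma>01 by (intro divide_left_mono) auto
    show "0 \<le> r" using \<rho>01 \<gamma>01 by (simp add: r_def)
  qed
  have "\<bar>FCR P \<alpha> mu g \<kappa> C U - \<alpha>\<bar> \<le>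
      2 * (real I_u * b / \<gamma>) + (32 * a + 90 * (real I_c * b)) * (1 / \<gamma>) + 2 * (real I_c * b) * (1 / \<gamma>\<^sup>2)"
    using abs_FCR_minus_le CU m4 by (simp add: a_def b_def)
  also have "\<dots> \<le> 2 * (real I_u * b / \<gamma>) + (32 * a + 90 * (real I_c * b)) * r + 2 * (real I_c * b) * r"
    using a0 r by (intro add_mono mult_left_mono order_refl) auto
  \<comment> \<open>92 is 90 + 2, the total coefficient of the \<open>I_c\<close> terms; the other
    two coefficients, 32 and 2, are smaller.\<close>
  also have "\<dots> \<le> 92 * (r * (real I_c * b + a) + real I_u * b / \<gamma>)"
  proof -
    have "0 \<le> a * r" using a0 r by simp
    moreover have "92 * (r * (real I_c * b + a) + real I_u * b / \<gamma>) = 2 * (real I_u * b / \<gamma>) + (32 * a + 90 * (real I_c * b)) * r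
        + 2 * (real I_c * b) * r + (90 * (real I_u * b / \<gamma>) + 60 * (a * r))"
      by (simp add: algebra_simps)
    ultimately show ?thesis using a0(3) by linarith
  qed
  also have "\<dots> = 92 * ((1 / (\<rho> * \<gamma> ^ 3)) * (real I_c * ln (real m) / real m + ln (real n) / real n)
           + real I_u * ln (real m) / (real m * \<gamma>))"
    by (simp add: r_def a_def b_def)
  finally show "\<bar>FCR P \<alpha> mu g \<kappa> C U - \<alpha>\<bar> \<le>
      92 * ((1 / (\<rho> * \<gamma> ^ 3)) * (real I_c * ln (real m) / real m + ln (real n) / real n)
           + real I_u * ln (real m) / (real m * \<gamma>))" .
qed

end
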